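(* Let $S_u$ be the unilateral operator weighted shift on $\widehat{\mathcal H}$ with weight sequence $(A_n)_{n\ge 0}$. If $S_u$ satisfies Dunford's condition $(C)$, then $r(S_u)=R_3^+(S_u)$ and, moreover, for every non-zero $x\in\mathcal H$, $$\limsup_{n\to+\infty}\|B_nx\|^{\frac1n}=\lim_{n\to+\infty}\bigg[\sup_{k\ge 0}\frac{\|B_{n+k}x\|}{\|B_kx\|}\bigg]^{\frac1n}.$$
   Context: $\mathcal H$ is a non-zero complex Hilbert space, $\mathcal L(\mathcal H)$ is the algebra of bounded linear operators on $\mathcal H$, and $(A_n)_{n\ge0}$ is a uniformly bounded sequence of invertible operators in $\mathcal L(\mathcal H)$ (no uniform bound on the inverses is assumed). $\widehat{\mathcal H}=\sum_{n\ge0}\oplus\mathcal H$ is the Hilbert space of sequences $(x_n)_{n\ge0}$ in $\mathcal H$ with $\sum_n\|x_n\|^2<\infty$. The unilateral operator weighted shift $S_u$ on $\widehat{\mathcal H}$ is $S_u(x_0,x_1,x_2,\dots)=(0,A_0x_0,A_1x_1,A_2x_2,\dots)$. Set $B_0=I$ and $B_n=A_{n-1}A_{n-2}\cdots A_1A_0$ for $n>0$. $r(\cdot)$ denotes the spectral radius, and $$R_3^+(S_u):=\sup_{x\in\mathcal H,\ x\ne0}\ \limsup_{n\to+\infty}\|B_nx\|^{\frac1n}.$$ For a bounded operator $T$ on a Hilbert space $\mathcal K$ and $x\in\mathcal K$, the local resolvent set $\rho_T(x)$ is the union of all open sets $U\subset\mathbb C$ for which there is an analytic $f:U\to\mathcal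 K$ with $(T-\lambda)f(\lambda)=x$ for all $\lambda\in U$; the local spectrum is $\sigma_T(x)=\mathbb C\setminus\rho_T(x)$. $T$ satisfies Dunford's condition $(C)$ if for every closed $F\subset\mathbb C$ the linear subspace $\{x\in\mathcal K:\sigma_T(x)\subset F\}$ is closed. *)

theory Defs
  imports "HOL-Analysis.Analysis"
begin

section \<open>Complex Hilbert spaces\<close>

class complex_vector = real_vector +
  fixes scaleC :: "complex \<Rightarrow> 'a \<Rightarrow> 'a" (infixr \<open>*\<^sub>C\<close> 75)
  assumes scaleC_add_right: "c *\<^sub>C (x + y) = c *\<^sub>C x + c *\<^sub>C y"
    and scaleC_add_left: "(c + d) *\<^sub>C x = c *\<^sub>C x + d *\<^sub>C x"
    and scaleC_scaleC: "c *\<^sub>C (d *\<^sub>C x) = (c * d) *\<^sub>C x"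
    and scaleR_scaleC: "r *\<^sub>R x = complex_of_real r *\<^sub>C x"

text \<open>
  The inner product is linear in its first argument. Together with \<open>cinner_commute\<close>, the last
  two axioms make it positive definite; completeness is part of class \<^class>\<open>banach\<close>.
\<close>

class complex_hilbert = complex_vector + banach +
  fixes cinner :: "'a \<Rightarrow> 'a \<Rightarrow> complex"
  assumes cinner_commute: "cinner x y = cnj (cinner y x)"
    and cinner_add_left: "cinner (x + y) z = cinner x z + cinner y z"
    and cinner_scaleC_left: "cinner (c *\<^sub>C x) y = c * cinner x y"
    and cinner_self_nonneg: "0 \<le> Re (cinner x x)"
    and norm_eq_sqrt_cinner: "norm x = sqrt (Re (cinner x x))"

lemma scaleC_one [simp]: "1 *\<^sub>C x = x"
  using scaleR_scaleC[of 1 x] by simp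

lemma cinner_scaleC_right: "cinner x (c *\<^sub>C y) = cnj c * cinner x y"
  by (metis cinner_commute cinner_scaleC_left complex_cnj_mult)

lemma cinner_add_right: "cinner x (y + z) = cinner x y + cinner x z"
  by (metis cinner_commute cinner_add_left complex_cnj_add)

lemma norm_squared_eq_cinner: "(norm x)\<^sup>2 = Re (cinner x x)"
  by (simp add: norm_eq_sqrt_cinner cinner_self_nonneg)

lemma cinner_self: "cinner x x = complex_of_real ((norm x)\<^sup>2)"
proof -
  have "Im (cinner x x) = 0"
    using arg_cong[OF cinner_commute[of x x], of Im] by simp
  then show ?thesis
    by (simp add: complex_eq_iff norm_squared_eq_cinner)
qed

lemma norm_scaleC: "norm (c *\<^sub>C x) = cmod c * norm x"
  for x :: "'a::complex_hilbert"
proof -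
  have "complex_of_real ((norm (c *\<^sub>C x))\<^sup>2) = (c * cnj c) * complex_of_real ((norm x)\<^sup>2)"
    by (simp only: cinner_self[symmetric] cinner_scaleC_left cinner_scaleC_right mult_ac)
  also have "\<dots> = complex_of_real ((cmod c * norm x)\<^sup>2)"
    by (simp only: complex_norm_square[symmetric] power_mult_distrib of_real_mult)
  finally have "(norm (c *\<^sub>C x))\<^sup>2 = (cmod c * norm x)\<^sup>2"
    by (simp only: of_real_eq_iff)
  then show ?thesis
    by (simp add: power2_eq_iff_nonneg)
qed

lemma norm_add_squared: "(norm (x + y))\<^sup>2 = (norm x)\<^sup>2 + (norm y)\<^sup>2 + 2 * Re (cinner x y)"
  for x y :: "'a::complex_hilbert"
  using arg_cong[OF cinner_commute[of y x], of Re]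
  by (simp add: norm_squared_eq_cinner cinner_add_left cinner_add_right)

lemma Re_cinner_bound: "\<bar>Re (cinner x y)\<bar> \<le> (norm x)\<^sup>2 + (norm y)\<^sup>2"
  for x y :: "'a::complex_hilbert"
proof -
  have "(norm (x + y))\<^sup>2 = (norm x)\<^sup>2 + (norm y)\<^sup>2 + 2 * Re (cinner x y)"
    by (rule norm_add_squared)
  moreover have "(norm (x + (- 1) *\<^sub>C y))\<^sup>2 = (norm x)\<^sup>2 + (norm y)\<^sup>2 - 2 * Re (cinner x y)"
    by (simp add: norm_add_squared cinner_scaleC_right norm_scaleC)
  ultimately show ?thesis
    using zero_le_power2[of "norm (x + y)"] zero_le_power2[of "norm (x + (- 1) *\<^sub>C y)"]
    by (simp add: abs_if)
qed

lemma norm_cinner_bound: "cmod (cinner x y) \<le> 2 * ((norm x)\<^sup>2 + (norm y)\<^sup>2)"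
  for x y :: "'a::complex_hilbert"
proof -
  have "\<bar>Im (cinner x y)\<bar> \<le> (norm x)\<^sup>2 + (norm y)\<^sup>2"
    using Re_cinner_bound[of "\<i> *\<^sub>C x" y] by (simp add: cinner_scaleC_left norm_scaleC)
  then show ?thesis
    using Re_cinner_bound[of x y] order_trans[OF cmod_le[of "cinner x y"] add_mono] by fastforce
qed

section \<open>The Hilbert sum of countably many copies of a space\<close>

typedef (overloaded) 'h hilbert_sum =
  "{x :: nat \<Rightarrow> 'h::real_normed_vector. summable (\<lambda>n. (norm (x n))\<^sup>2)}"
  morphisms coord Abs_hilbert_sum
  by (rule exI[of _ "\<lambda>_. 0"]) simp

setup_lifting type_definition_hilbert_sum

lemma summable_coord: "summable (\<lambda>n. (norm (coord x n))\<^sup>2)"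
  using coord[of x] by simp

lemma hilbert_sum_eqI: "(\<And>n. coord x n = coord y n) \<Longrightarrow> x = y"
  by (metis coord_inject ext)

lemma norm_add_squared_le: "(norm (x + y))\<^sup>2 \<le> 2 * ((norm x)\<^sup>2 + (norm y)\<^sup>2)"
  for x y :: "'a::real_normed_vector"
proof -
  have "(norm (x + y))\<^sup>2 \<le> (norm x + norm y)\<^sup>2"
    by (intro power_mono norm_triangle_ineq) simp
  also have "\<dots> \<le> 2 * ((norm x)\<^sup>2 + (norm y)\<^sup>2)"
    using zero_le_power2[of "norm x - norm y"] by (simp add: power2_eq_square algebra_simps)
  finally show ?thesis .
qed

lemma square_summable_add:
  fixes x y :: "nat \<Rightarrow> 'a::real_normed_vector"
  assumes "summable (\<lambda>n. (norm (x n))\<^sup>2)" and "summable (\<lambda>n. (norm (y n))\<^sup>2)"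
  shows "summable (\<lambda>n. (norm (x n + y n))\<^sup>2)"
proof (rule summable_comparison_test'[where N = 0])
  show "summable (\<lambda>n. 2 * ((norm (x n))\<^sup>2 + (norm (y n))\<^sup>2))"
    by (intro summable_mult summable_add assms)
  show "norm ((norm (x n + y n))\<^sup>2) \<le> 2 * ((norm (x n))\<^sup>2 + (norm (y n))\<^sup>2)" for n
    using norm_add_squared_le[of "x n" "y n"] by simp
qed

instantiation hilbert_sum :: (real_normed_vector) real_vector
begin

lift_definition zero_hilbert_sum :: "'a hilbert_sum" is "\<lambda>_. 0"
  by simp

lift_definition plus_hilbert_sum :: "'a hilbert_sum \<Rightarrow> 'a hilbert_sum \<Rightarrow> 'a hilbert_sum"
  is "\<lambda>x y n. x n + y n"
  by (rule square_summable_add)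

lift_definition uminus_hilbert_sum :: "'a hilbert_sum \<Rightarrow> 'a hilbert_sum" is "\<lambda>x n. - x n"
  by simp

lift_definition minus_hilbert_sum :: "'a hilbert_sum \<Rightarrow> 'a hilbert_sum \<Rightarrow> 'a hilbert_sum"
  is "\<lambda>x y n. x n - y n"
proof -
  fix x y :: "nat \<Rightarrow> 'a"
  assume "summable (\<lambda>n. (norm (x n))\<^sup>2)" and "summable (\<lambda>n. (norm (y n))\<^sup>2)"
  then show "summable (\<lambda>n. (norm (x n - y n))\<^sup>2)"
    using square_summable_add[of x "\<lambda>n. - y n"] by simp
qed

lift_definition scaleR_hilbert_sum :: "real \<Rightarrow> 'a hilbert_sum \<Rightarrow> 'a hilbert_sum"
  is "\<lambda>r x n. r *\<^sub>R x n"
  by (simp add: power_mult_distrib summable_mult)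

instance
  by standard (transfer; simp add: algebra_simps)+

end

lemmas coord_simps [simp] =
  zero_hilbert_sum.rep_eq plus_hilbert_sum.rep_eq uminus_hilbert_sum.rep_eq
  minus_hilbert_sum.rep_eq scaleR_hilbert_sum.rep_eq

instantiation hilbert_sum :: (real_normed_vector) real_normed_vector
begin

definition norm_hilbert_sum :: "'a hilbert_sum \<Rightarrow> real"
  where "norm_hilbert_sum x = sqrt (\<Sum>n. (norm (coord x n))\<^sup>2)"

definition dist_hilbert_sum :: "'a hilbert_sum \<Rightarrow> 'a hilbert_sum \<Rightarrow> real"
  where "dist_hilbert_sum x y = norm (x - y)"

definition sgn_hilbert_sum :: "'a hilbert_sum \<Rightarrow> 'a hilbert_sum"
  where "sgn_hilbert_sum x = x /\<^sub>R norm x"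

definition uniformity_hilbert_sum :: "('a hilbert_sum \<times> 'a hilbert_sum) filter"
  where "uniformity_hilbert_sum = (INF e\<in>{0<..}. principal {(x, y). dist x y < e})"

definition open_hilbert_sum :: "'a hilbert_sum set \<Rightarrow> bool"
  where "open_hilbert_sum U = (\<forall>x\<in>U. \<forall>\<^sub>F (x', y) in uniformity. x' = x \<longrightarrow> y \<in> U)"

instance
proof
  fix x y :: "'a hilbert_sum" and r :: real
  show "(norm x = 0) = (x = 0)"
  proof
    assume "norm x = 0"
    then have "(\<Sum>n. (norm (coord x n))\<^sup>2) = 0"
      by (simp add: norm_hilbert_sum_def)
    then have "\<forall>n. (norm (coord x n))\<^sup>2 = 0"
      by (subst (asm) suminf_eq_zero_iff) (auto intro: summable_coord)
    then show "x = 0"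
      by (intro hilbert_sum_eqI) simp
  qed (simp add: norm_hilbert_sum_def)
  show "norm (r *\<^sub>R x) = \<bar>r\<bar> * norm x"
    by (simp add: norm_hilbert_sum_def power_mult_distrib suminf_mult summable_coord real_sqrt_mult)
  show "norm (x + y) \<le> norm x + norm y"
  proof -
    have fin: "L2_set (\<lambda>n. norm (coord z n)) {..<k} \<le> norm z" for z :: "'a hilbert_sum" and k
      unfolding L2_set_def norm_hilbert_sum_def
      by (intro real_sqrt_le_mono sum_le_suminf summable_coord) auto
    have "L2_set (\<lambda>n. norm (coord (x + y) n)) {..<k} \<le> norm x + norm y" for k
    proof -
      have "L2_set (\<lambda>n. norm (coord (x + y) n)) {..<k}
          \<le> L2_set (\<lambda>n. norm (coord x n) + norm (coord y n)) {..<k}"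
        by (rule L2_set_mono) (auto intro: norm_triangle_ineq)
      also have "\<dots> \<le> L2_set (\<lambda>n. norm (coord x n)) {..<k} + L2_set (\<lambda>n. norm (coord y n)) {..<k}"
        by (rule L2_set_triangle_ineq)
      also have "\<dots> \<le> norm x + norm y"
        by (intro add_mono fin)
      finally show ?thesis .
    qed
    moreover have "(\<lambda>k. L2_set (\<lambda>n. norm (coord (x + y) n)) {..<k}) \<longlonglongrightarrow> norm (x + y)"
      unfolding L2_set_def norm_hilbert_sum_def
      by (intro tendsto_real_sqrt summable_LIMSEQ summable_coord)
    ultimately show ?thesis
      by (intro LIMSEQ_le_const2) auto
  qed
qed (rule dist_hilbert_sum_def sgn_hilbert_sum_def uniformity_hilbert_sum_def
      open_hilbert_sum_def)+

end

lemma norm_squared_hilbert_sum: "(norm x)\<^sup>2 = (\<Sum>n. (norm (coord x n))\<^sup>2)"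
  by (simp add: norm_hilbert_sum_def suminf_nonneg summable_coord)

lemma partial_sum_le_norm: "(\<Sum>n<k. (norm (coord x n))\<^sup>2) \<le> (norm x)\<^sup>2"
  unfolding norm_squared_hilbert_sum by (intro sum_le_suminf summable_coord) auto

lemma norm_coord_le: "norm (coord x n) \<le> norm x"
proof -
  have "(norm (coord x n))\<^sup>2 \<le> (\<Sum>i<Suc n. (norm (coord x i))\<^sup>2)"
    by (intro member_le_sum) auto
  also have "\<dots> \<le> (norm x)\<^sup>2"
    by (rule partial_sum_le_norm)
  finally show ?thesis
    by (rule power2_le_imp_le) simp
qed

instance hilbert_sum :: (banach) banach
proof
  fix X :: "nat \<Rightarrow> 'a hilbert_sum"
  assume X: "Cauchy X"
  have "Cauchy (\<lambda>m. coord (X m) n)" for n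
  proof (rule metric_CauchyI)
    fix e :: real assume "0 < e"
    from metric_CauchyD[OF X this] obtain M where
      "\<And>m m'. m \<ge> M \<Longrightarrow> m' \<ge> M \<Longrightarrow> dist (X m) (X m') < e" by blast
    moreover have "dist (coord (X m) n) (coord (X m') n) \<le> dist (X m) (X m')" for m m'
      using norm_coord_le[of "X m - X m'" n] by (simp add: dist_norm)
    ultimately show "\<exists>M. \<forall>m\<ge>M. \<forall>m'\<ge>M. dist (coord (X m) n) (coord (X m') n) < e"
      by (meson le_less_trans)
  qed
  then have "\<exists>l. (\<lambda>m. coord (X m) n) \<longlonglongrightarrow> l" for n
    by (simp add: Cauchy_convergent convergent_def[symmetric])
  then obtain L where L: "\<And>n. (\<lambda>m. coord (X m) n) \<longlonglongrightarrow> L n"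
    by metis
  have bound: "\<exists>M. \<forall>m\<ge>M. \<forall>k. (\<Sum>n<k. (norm (coord (X m) n - L n))\<^sup>2) \<le> e\<^sup>2" if "0 < e" for e
  proof -
    from metric_CauchyD[OF X that] obtain M where
      M: "\<And>m m'. m \<ge> M \<Longrightarrow> m' \<ge> M \<Longrightarrow> dist (X m) (X m') < e" by blast
    have "(\<Sum>n<k. (norm (coord (X m) n - L n))\<^sup>2) \<le> e\<^sup>2" if "m \<ge> M" for m k
    proof (rule LIMSEQ_le_const2)
      show "(\<lambda>m'. \<Sum>n<k. (norm (coord (X m) n - coord (X m') n))\<^sup>2)
          \<longlonglongrightarrow> (\<Sum>n<k. (norm (coord (X m) n - L n))\<^sup>2)"
        by (intro tendsto_intros L)
      have "(\<Sum>n<k. (norm (coord (X m) n - coord (X m') n))\<^sup>2) \<le> e\<^sup>2" if "m' \<ge> M" for m'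
      proof -
        have "(\<Sum>n<k. (norm (coord (X m - X m') n))\<^sup>2) \<le> (norm (X m - X m'))\<^sup>2"
          by (rule partial_sum_le_norm)
        also have "\<dots> \<le> e\<^sup>2"
          using M[OF \<open>m \<ge> M\<close> that] by (intro power_mono) (auto simp: dist_norm)
        finally show ?thesis by simp
      qed
      then show "\<exists>N. \<forall>m'\<ge>N. (\<Sum>n<k. (norm (coord (X m) n - coord (X m') n))\<^sup>2) \<le> e\<^sup>2"
        by blast
    qed
    then show ?thesis by blast
  qed
  have diff: "summable (\<lambda>n. (norm (coord (X m) n - L n))\<^sup>2)"
    if "\<And>k. (\<Sum>n<k. (norm (coord (X m) n - L n))\<^sup>2) \<le> e\<^sup>2" for m e
    by (rule bounded_imp_summable[where B = "e\<^sup>2"])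
      (use that[of "Suc _"] in \<open>auto simp: lessThan_Suc_atMost\<close>)
  obtain m0 where m0: "\<And>k. (\<Sum>n<k. (norm (coord (X m0) n - L n))\<^sup>2) \<le> 1\<^sup>2"
    using bound[of 1] by auto
  have "summable (\<lambda>n. (norm (L n))\<^sup>2)"
  proof -
    have "summable (\<lambda>n. (norm (- (coord (X m0) n - L n)))\<^sup>2)"
      using diff[OF m0] by (subst norm_minus_cancel)
    from square_summable_add[OF summable_coord[of "X m0"] this] show ?thesis
      by simp
  qed
  then have coord_L: "coord (Abs_hilbert_sum L) = L"
    by (simp add: Abs_hilbert_sum_inverse)
  have "X \<longlonglongrightarrow> Abs_hilbert_sum L"
  proof (rule metric_LIMSEQ_I)
    fix r :: real assume "0 < r"
    then obtain M where M: "\<And>m k. m \<ge> M \<Longrightarrow>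
        (\<Sum>n<k. (norm (coord (X m) n - L n))\<^sup>2) \<le> (r / 2)\<^sup>2"
      using bound[of "r / 2"] by auto
    have "dist (X m) (Abs_hilbert_sum L) < r" if "m \<ge> M" for m
    proof -
      have "(norm (X m - Abs_hilbert_sum L))\<^sup>2 \<le> (r / 2)\<^sup>2"
        unfolding norm_squared_hilbert_sum
        by (rule suminf_le_const[OF summable_coord]) (use M[OF that] in \<open>simp add: coord_L\<close>)
      then have "norm (X m - Abs_hilbert_sum L) \<le> r / 2"
        by (rule power2_le_imp_le) (use \<open>0 < r\<close> in simp)
      then show ?thesis
        using \<open>0 < r\<close> by (simp add: dist_norm)
    qed
    then show "\<exists>M. \<forall>m\<ge>M. dist (X m) (Abs_hilbert_sum L) < r" by blast
  qed
  then show "convergent X"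
    by (rule convergentI)
qed

lemma summable_cinner_coord: "summable (\<lambda>n. cinner (coord x n) (coord y n))"
  for x y :: "'a::complex_hilbert hilbert_sum"
proof (rule summable_comparison_test'[where N = 0])
  show "summable (\<lambda>n. 2 * ((norm (coord x n))\<^sup>2 + (norm (coord y n))\<^sup>2))"
    by (intro summable_mult summable_add summable_coord)
qed (rule norm_cinner_bound)

instantiation hilbert_sum :: (complex_hilbert) complex_hilbert
begin

lift_definition scaleC_hilbert_sum :: "complex \<Rightarrow> 'a hilbert_sum \<Rightarrow> 'a hilbert_sum"
  is "\<lambda>c x n. c *\<^sub>C x n"
  by (simp add: norm_scaleC power_mult_distrib summable_mult)

definition cinner_hilbert_sum :: "'a hilbert_sum \<Rightarrow> 'a hilbert_sum \<Rightarrow> complex"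
  where "cinner_hilbert_sum x y = (\<Sum>n. cinner (coord x n) (coord y n))"

instance
proof
  fix x y z :: "'a hilbert_sum" and c d :: complex and r :: real
  show "c *\<^sub>C (x + y) = c *\<^sub>C x + c *\<^sub>C y"
    by transfer (simp add: scaleC_add_right)
  show "(c + d) *\<^sub>C x = c *\<^sub>C x + d *\<^sub>C x"
    by transfer (simp add: scaleC_add_left)
  show "c *\<^sub>C (d *\<^sub>C x) = (c * d) *\<^sub>C x"
    by transfer (simp add: scaleC_scaleC)
  show "r *\<^sub>R x = complex_of_real r *\<^sub>C x"
    by transfer (simp add: scaleR_scaleC)
  show "cinner x y = cnj (cinner y x)"
  proof -
    have "(\<lambda>n. cnj (cinner (coord y n) (coord x n))) sums cnj (cinner y x)"
      unfolding sums_cnj cinner_hilbert_sum_def by (intro summable_sums summable_cinner_coord)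
    then have "(\<lambda>n. cinner (coord x n) (coord y n)) sums cnj (cinner y x)"
      by (simp add: cinner_commute[symmetric])
    then show ?thesis
      unfolding cinner_hilbert_sum_def by (simp add: sums_unique[symmetric])
  qed
  show "cinner (x + y) z = cinner x z + cinner y z"
    by (simp add: cinner_hilbert_sum_def cinner_add_left suminf_add summable_cinner_coord)
  show "cinner (c *\<^sub>C x) y = c * cinner x y"
    by (simp add: cinner_hilbert_sum_def scaleC_hilbert_sum.rep_eq cinner_scaleC_left
        suminf_mult summable_cinner_coord)
  have *: "Re (cinner x x) = (\<Sum>n. (norm (coord x n))\<^sup>2)"
    by (simp add: cinner_hilbert_sum_def cinner_self suminf_of_real[symmetric] summable_coord
        del: of_real_power)
  show "0 \<le> Re (cinner x x)"
    unfolding * by (intro suminf_nonneg summable_coord) simp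
  show "norm x = sqrt (Re (cinner x x))"
    unfolding * by (rule norm_hilbert_sum_def)
qed

end

declare scaleC_hilbert_sum.rep_eq [simp]

section \<open>Bounded operators, spectrum and local spectrum\<close>

definition bounded_clinear :: "('a::complex_hilbert \<Rightarrow> 'b::complex_hilbert) \<Rightarrow> bool"
  where "bounded_clinear T \<longleftrightarrow> bounded_linear T \<and> (\<forall>c x. T (c *\<^sub>C x) = c *\<^sub>C T x)"

definition invertible_op :: "('a::complex_hilbert \<Rightarrow> 'a) \<Rightarrow> bool"
  where "invertible_op T \<longleftrightarrow>
    bounded_clinear T \<and> (\<exists>S. bounded_clinear S \<and> S \<circ> T = id \<and> T \<circ> S = id)"

definition op_spectrum :: "('a::complex_hilbert \<Rightarrow> 'a) \<Rightarrow> complex set"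
  where "op_spectrum T = {\<mu>. \<not> invertible_op (\<lambda>x. T x - \<mu> *\<^sub>C x)}"

text \<open>
  The supremum is taken in \<^typ>\<open>real\<close>: the spectrum of a bounded operator on a non-zero space is
  non-empty and bounded, so no junk value of \<^const>\<open>Sup\<close> is involved.
\<close>

definition op_spectral_radius :: "('a::complex_hilbert \<Rightarrow> 'a) \<Rightarrow> real"
  where "op_spectral_radius T = (SUP \<mu>\<in>op_spectrum T. cmod \<mu>)"

text \<open>Complex differentiability at every point of \<open>U\<close>, to be used for open \<open>U\<close>.\<close>

definition vector_analytic_on :: "(complex \<Rightarrow> 'a::complex_hilbert) \<Rightarrow> complex set \<Rightarrow> bool"
  where "vector_analytic_on f U \<longleftrightarrow> (\<forall>z\<in>U. \<exists>d. (f has_derivative (\<lambda>h. h *\<^sub>C d)) (at z))"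

definition local_resolvent_set :: "('a::complex_hilbert \<Rightarrow> 'a) \<Rightarrow> 'a \<Rightarrow> complex set"
  where "local_resolvent_set T x =
    \<Union>{U. open U \<and> (\<exists>f. vector_analytic_on f U \<and> (\<forall>\<mu>\<in>U. T (f \<mu>) - \<mu> *\<^sub>C f \<mu> = x))}"

definition local_spectrum :: "('a::complex_hilbert \<Rightarrow> 'a) \<Rightarrow> 'a \<Rightarrow> complex set"
  where "local_spectrum T x = - local_resolvent_set T x"

definition dunford_condition_C :: "('a::complex_hilbert \<Rightarrow> 'a) \<Rightarrow> bool"
  where "dunford_condition_C T \<longleftrightarrow>
    (\<forall>F. closed F \<longrightarrow> closed {x. local_spectrum T x \<subseteq> F})"

section \<open>Unilateral operator weighted shifts\<close>

text \<open>
  If the weights are not uniformly bounded, the sequence below need not be square summable and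
  the value is unspecified; see \<open>coord_unilateral_shift\<close> for the bounded case.
\<close>

definition unilateral_shift ::
    "(nat \<Rightarrow> 'h::complex_hilbert \<Rightarrow> 'h) \<Rightarrow> 'h hilbert_sum \<Rightarrow> 'h hilbert_sum"
  where "unilateral_shift A x =
    Abs_hilbert_sum (\<lambda>n. case n of 0 \<Rightarrow> 0 | Suc k \<Rightarrow> A k (coord x k))"

fun weight_product :: "(nat \<Rightarrow> 'h \<Rightarrow> 'h) \<Rightarrow> nat \<Rightarrow> 'h \<Rightarrow> 'h"
  where
    "weight_product A 0 = id"
  | "weight_product A (Suc n) = A n \<circ> weight_product A n"

text \<open>
  The \<open>n\<close>-th roots are those of \<^const>\<open>root\<close>; the term for \<open>n = 0\<close>, where \<open>root 0 t = 0\<close>,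
  does not affect the limit superior.
\<close>

definition R3_plus :: "(nat \<Rightarrow> 'h::complex_hilbert \<Rightarrow> 'h) \<Rightarrow> ereal"
  where "R3_plus A =
    (SUP x\<in>{x. x \<noteq> 0}. limsup (\<lambda>n. ereal (root n (norm (weight_product A n x)))))"

definition uniformly_bounded_weights :: "(nat \<Rightarrow> 'h::complex_hilbert \<Rightarrow> 'h) \<Rightarrow> bool"
  where "uniformly_bounded_weights A \<longleftrightarrow>
    (\<forall>n. bounded_clinear (A n)) \<and> bdd_above (range (\<lambda>n. onorm (A n)))"

lemma uniformly_bounded_weightsE:
  assumes "uniformly_bounded_weights A"
  obtains M where "0 \<le> M" and "\<And>n x. norm (A n x) \<le> M * norm x"
proof -
  from assms obtain M where M: "\<And>n. onorm (A n) \<le> M"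
    unfolding uniformly_bounded_weights_def bdd_above_def by auto
  have bl: "bounded_linear (A n)" for n
    using assms by (simp add: uniformly_bounded_weights_def bounded_clinear_def)
  have "norm (A n x) \<le> M * norm x" for n x
    by (rule order_trans[OF onorm[OF bl]]) (intro mult_right_mono M norm_ge_zero)
  moreover have "0 \<le> M"
    using onorm_pos_le[OF bl[of 0]] M[of 0] by linarith
  ultimately show thesis
    using that by blast
qed

lemma shifted_weights_bounds:
  assumes "0 \<le> M" and "\<And>n x. norm (A n x) \<le> M * norm (x :: 'h::complex_hilbert)"
  shows "summable (\<lambda>n. (norm (A n (coord x n)))\<^sup>2)"
    and "(\<Sum>n. (norm (A n (coord x n)))\<^sup>2) \<le> M\<^sup>2 * (norm x)\<^sup>2"
proof -
  have le: "(norm (A n (coord x n)))\<^sup>2 \<le> M\<^sup>2 * (norm (coord x n))\<^sup>2" for n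
    using power_mono[OF assms(2)[of n "coord x n"] norm_ge_zero, of 2] by (simp add: power_mult_distrib)
  have s: "summable (\<lambda>n. M\<^sup>2 * (norm (coord x n))\<^sup>2)"
    by (intro summable_mult summable_coord)
  show summ: "summable (\<lambda>n. (norm (A n (coord x n)))\<^sup>2)"
    by (rule summable_comparison_test'[OF s, where N = 0]) (use le in simp)
  show "(\<Sum>n. (norm (A n (coord x n)))\<^sup>2) \<le> M\<^sup>2 * (norm x)\<^sup>2"
    using suminf_le[OF le summ s]
    by (simp add: norm_squared_hilbert_sum suminf_mult summable_coord)
qed

lemma coord_unilateral_shift:
  assumes "uniformly_bounded_weights A"
  shows "coord (unilateral_shift A x) = (\<lambda>n. case n of 0 \<Rightarrow> 0 | Suc k \<Rightarrow> A k (coord x k))"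
proof -
  obtain M where "0 \<le> M" and "\<And>n y. norm (A n y) \<le> M * norm y"
    using uniformly_bounded_weightsE[OF assms] by blast
  then have "summable (\<lambda>n. (norm (A n (coord x n)))\<^sup>2)"
    by (rule shifted_weights_bounds)
  then have "summable (\<lambda>n. (norm (case n of 0 \<Rightarrow> 0 | Suc k \<Rightarrow> A k (coord x k)))\<^sup>2)"
    by (subst summable_Suc_iff[symmetric]) simp
  then show ?thesis
    by (simp add: unilateral_shift_def Abs_hilbert_sum_inverse)
qed

lemma bounded_clinear_unilateral_shift:
  assumes "uniformly_bounded_weights A"
  shows "bounded_clinear (unilateral_shift A)"
proof -
  note co = coord_unilateral_shift[OF assms]
  obtain M where M: "0 \<le> M" "\<And>n y. norm (A n y) \<le> M * norm y"
    using uniformly_bounded_weightsE[OF assms] by blast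
  have bl: "bounded_linear (A n)" and cl: "A n (c *\<^sub>C y) = c *\<^sub>C A n y" for n c y
    using assms by (auto simp: uniformly_bounded_weights_def bounded_clinear_def)
  have add: "unilateral_shift A (x + y) = unilateral_shift A x + unilateral_shift A y" for x y
    by (rule hilbert_sum_eqI)
      (simp add: co linear_add[OF bounded_linear.linear[OF bl]] split: nat.split)
  have zero: "c *\<^sub>C 0 = (0 :: 'a)" for c
    using scaleC_add_right[of c 0 "0 :: 'a"] by simp
  have scaleC: "unilateral_shift A (c *\<^sub>C x) = c *\<^sub>C unilateral_shift A x" for c x
    by (rule hilbert_sum_eqI) (simp add: co cl zero split: nat.split)
  have bound: "norm (unilateral_shift A x) \<le> norm x * M" for x
  proof -
    have "(norm (unilateral_shift A x))\<^sup>2 = (\<Sum>n. (norm (A n (coord x n)))\<^sup>2)"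
      unfolding norm_squared_hilbert_sum
      using suminf_split_head[OF summable_coord[of "unilateral_shift A x"]] by (simp add: co)
    also have "\<dots> \<le> (norm x * M)\<^sup>2"
      using shifted_weights_bounds(2)[where x = x, OF M] by (simp add: power_mult_distrib mult.commute)
    finally show ?thesis
      by (rule power2_le_imp_le) (simp add: M)
  qed
  have "bounded_linear (unilateral_shift A)"
    by (rule bounded_linear_intro[OF add _ bound]) (simp add: scaleR_scaleC scaleC)
  then show ?thesis
    by (simp add: bounded_clinear_def scaleC)
qed

end

theory Submission
  imports Defs
begin

text \<open>
  Write \<open>S\<close> for the shift and \<open>B n\<close> for the products of the weights. The powers of \<open>S\<close> move a vector
  \<open>B k x\<close> placed in coordinate \<open>k\<close> to \<open>B (k + n) x\<close> in coordinate \<open>k + n\<close>. If the norms of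
  \<open>B n x\<close> grow with exponential rate at most \<open>\<rho>\<close>, then the Neumann series solves
  \<open>(S - \<mu>) f = y\<close> analytically for \<open>\<bar>\<mu>\<bar> > \<rho>\<close> when \<open>y\<close> is such a vector, or a finite sum of such
  vectors. Condition (C) enters at one place: the vectors with local spectrum in the disc of radius \<open>\<rho>\<close>
  form a closed set, so the equation remains solvable for every \<open>y\<close> whose coordinates are of this
  kind, and not only for the finitely supported ones
  (\<open>local_spectrum_subset_cball_of_coords\<close>). As \<open>S - \<mu>\<close> is injective for \<open>\<mu> \<noteq> 0\<close>, the
  uniform boundedness principle turns solvability into a norm estimate for the solutions
  (\<open>solution_bounded\<close>).

  In the other direction no theory is needed: the equation \<open>(S - \<mu>) f = y\<close> can be solved coordinate
  by coordinate, and for \<open>y = B k x\<close> in coordinate \<open>k\<close> the solution has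
  \<open>- inverse \<mu> ^ (n + 1) B (k + n) x\<close> in coordinate \<open>k + n\<close>. Any bound on \<open>f\<close> is therefore an exponential
  bound on \<open>B (k + n) x\<close>, uniform in \<open>k\<close> if the bound on \<open>f\<close> is (\<open>norm_solution_coord\<close>).

  For the spectral radius, take all of the Hilbert sum as the set of right-hand sides. Every vector
  in coordinate \<open>k\<close> is some \<open>B k x\<close> because the weights are invertible, so \<open>S - \<mu>\<close> is invertible
  for \<open>\<bar>\<mu>\<bar>\<close> above the supremum of the rates; and the coordinate formula with \<open>k = 0\<close> shows that
  each rate is at most the spectral radius.

  For a single \<open>x\<close>, take the right-hand sides whose \<open>k\<close>-th coordinate is a real multiple of \<open>B k x\<close>.
  There the equation is solvable for \<open>\<bar>\<mu>\<bar>\<close> above the rate \<open>\<rho>\<close> of \<open>x\<close> itself, and the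
  norm estimate applied to the unit vectors
  \<open>B k x / \<parallel>B k x\<parallel>\<close> bounds the supremum over \<open>k\<close> of the ratios \<open>\<parallel>B (n + k) x\<parallel> / \<parallel>B k x\<parallel>\<close> by a
  multiple of \<open>t ^ n\<close> for each \<open>t > \<rho>\<close>. The reverse inequality is elementary: the supremum for a
  single \<open>n\<close> bounds the growth of \<open>B m x\<close> along progressions of step \<open>n\<close> in \<open>m\<close>, so its \<open>n\<close>-th
  root is at least \<open>\<rho>\<close> (\<open>root_of_ratio_bound_tendsto\<close>).
\<close>

section \<open>Exponential growth rates\<close>

text \<open>
  For non-negative \<open>u\<close> and \<open>\<rho>\<close> the rates strictly above \<open>\<rho>\<close> express
  \<open>limsup (root n (u n)) \<le> \<rho>\<close> without roots. In this form the
  condition is stable under sums and shifts of the index, and it is what the convergence of a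
  geometric series asks for.
\<close>

definition exp_growth_le :: "real \<Rightarrow> (nat \<Rightarrow> real) \<Rightarrow> bool"
  where "exp_growth_le \<rho> u \<longleftrightarrow> (\<forall>t>\<rho>. \<exists>C. \<forall>n. u n \<le> C * t ^ n)"

lemma exp_growth_leD:
  assumes "exp_growth_le \<rho> u" and "\<rho> < t"
  shows "\<exists>C. \<forall>n. u n \<le> C * t ^ n"
  using assms unfolding exp_growth_le_def by blast

lemma exp_growth_le_iff_limsup:
  assumes "0 \<le> \<rho>" and u: "\<And>n. 0 \<le> u n"
  shows "exp_growth_le \<rho> u \<longleftrightarrow> limsup (\<lambda>n. ereal (root n (u n))) \<le> ereal \<rho>"
proof
  assume growth: "exp_growth_le \<rho> u"
  show "limsup (\<lambda>n. ereal (root n (u n))) \<le> ereal \<rho>"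
    unfolding Limsup_le_iff
  proof (intro allI impI)
    fix y assume "ereal \<rho> < y"
    then obtain s where s: "\<rho> < s" "ereal s < y"
      using ereal_dense2 by (metis ereal_less_ereal_Ex less_ereal.simps(1))
    then obtain t where t: "\<rho> < t" "t < s"
      using dense[OF s(1)] by blast
    obtain C where C: "\<And>n. u n \<le> C * t ^ n"
      using exp_growth_leD[OF growth t(1)] by blast
    have "0 < t"
      using assms(1) t by simp
    \<comment> \<open>The roots of a positive constant tend to 1, so passing from \<open>t\<close> to \<open>s\<close> absorbs it.\<close>
    have "(\<lambda>n. root n (max C 1) * t) \<longlonglongrightarrow> 1 * t"
      by (intro tendsto_intros LIMSEQ_root_const) simp
    then have "\<forall>\<^sub>F n in sequentially. root n (max C 1) * t < s"
      using t by (intro order_tendstoD(2)) auto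
    then show "\<forall>\<^sub>F n in sequentially. ereal (root n (u n)) < y"
      using eventually_gt_at_top[of 0]
    proof eventually_elim
      case (elim n)
      have "u n \<le> max C 1 * t ^ n"
        using C[of n] \<open>0 < t\<close> by (meson max.cobounded1 mult_right_mono order_trans zero_le_power less_imp_le)
      then have "root n (u n) \<le> root n (max C 1) * t"
        using elim \<open>0 < t\<close> real_root_le_mono[of n "u n" "max C 1 * t ^ n"]
        by (simp add: real_root_mult real_root_power_cancel)
      then have "root n (u n) < s"
        using elim by linarith
      then show ?case
        using s(2) by (meson ereal_less_eq(3) less_imp_le order_le_less_trans)
    qed
  qed
next
  assume le: "limsup (\<lambda>n. ereal (root n (u n))) \<le> ereal \<rho>"
  show "exp_growth_le \<rho> u"
    unfolding exp_growth_le_def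
  proof (intro allI impI)
    fix t assume "\<rho> < t"
    then have "\<forall>\<^sub>F n in sequentially. root n (u n) < t"
      using le[unfolded Limsup_le_iff, rule_format, of "ereal t"] by simp
    then obtain N where N: "\<And>n. n \<ge> N \<Longrightarrow> root n (u n) < t"
      by (auto simp: eventually_sequentially)
    have "0 < t"
      using assms(1) \<open>\<rho> < t\<close> by simp
    \<comment> \<open>The sum covers the terms up to \<open>N\<close> and the summand 1 the later ones.\<close>
    define C where "C = 1 + (\<Sum>i\<le>N. u i / t ^ i)"
    have "u n \<le> C * t ^ n" for n
    proof (cases "n \<le> N")
      case True
      then have "u n / t ^ n \<le> (\<Sum>i\<le>N. u i / t ^ i)"
        using u \<open>0 < t\<close> by (intro member_le_sum) auto
      then show ?thesis
        using \<open>0 < t\<close> by (simp add: C_def divide_simps algebra_simps add_increasing)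
    next
      case False
      then have "u n = root n (u n) ^ n"
        using u by simp
      also have "\<dots> \<le> t ^ n"
        using N[of n] False u by (intro power_mono) auto
      also have "\<dots> \<le> C * t ^ n"
        using u \<open>0 < t\<close> by (simp add: C_def sum_nonneg)
      finally show ?thesis .
    qed
    then show "\<exists>C. \<forall>n. u n \<le> C * t ^ n"
      by blast
  qed
qed


lemma exp_growth_le_zero: "0 \<le> \<rho> \<Longrightarrow> exp_growth_le \<rho> (\<lambda>n. 0)"
  by (auto simp: exp_growth_le_def intro!: exI[of _ 0])

lemma exp_growth_le_mono:
  assumes "exp_growth_le \<rho> u" and "\<And>n. w n \<le> u n"
  shows "exp_growth_le \<rho> w"
  using assms unfolding exp_growth_le_def by (meson order_trans)

lemma exp_growth_le_add:
  assumes "exp_growth_le \<rho> u" and "exp_growth_le \<rho> w"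
  shows "exp_growth_le \<rho> (\<lambda>n. u n + w n)"
  unfolding exp_growth_le_def
proof (intro allI impI)
  fix t assume "\<rho> < t"
  then obtain C D where "\<And>n. u n \<le> C * t ^ n" "\<And>n. w n \<le> D * t ^ n"
    using assms by (meson exp_growth_leD)
  then have "u n + w n \<le> (C + D) * t ^ n" for n
    by (simp add: distrib_right add_mono)
  then show "\<exists>C. \<forall>n. u n + w n \<le> C * t ^ n"
    by blast
qed

lemma exp_growth_le_shift:
  assumes "exp_growth_le \<rho> u"
  shows "exp_growth_le \<rho> (\<lambda>n. u (k + n))"
  unfolding exp_growth_le_def
proof (intro allI impI)
  fix t assume "\<rho> < t"
  then obtain C where "\<And>n. u n \<le> C * t ^ n"
    using exp_growth_leD[OF assms] by blast
  from this[of "k + _"] have "u (k + n) \<le> (C * t ^ k) * t ^ n" for n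
    by (simp add: power_add mult.assoc)
  then show "\<exists>C. \<forall>n. u (k + n) \<le> C * t ^ n"
    by blast
qed

lemma exp_growth_le_cmult:
  assumes "exp_growth_le \<rho> u" and "0 \<le> c"
  shows "exp_growth_le \<rho> (\<lambda>n. c * u n)"
  unfolding exp_growth_le_def
proof (intro allI impI)
  fix t assume "\<rho> < t"
  then obtain C where "\<And>n. u n \<le> C * t ^ n"
    using exp_growth_leD[OF assms(1)] by blast
  then have "c * u n \<le> (c * C) * t ^ n" for n
    using assms(2) by (simp add: mult.assoc mult_left_mono)
  then show "\<exists>C. \<forall>n. c * u n \<le> C * t ^ n"
    by blast
qed

lemma exp_growth_le_geometric:
  assumes "0 \<le> \<rho>" and "0 \<le> C" and "\<And>n. u n \<le> C * \<rho> ^ n"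
  shows "exp_growth_le \<rho> u"
  unfolding exp_growth_le_def
proof (intro allI impI)
  fix t assume "\<rho> < t"
  then have "u n \<le> C * t ^ n" for n
    using assms by (intro order_trans[OF assms(3)] mult_left_mono power_mono) auto
  then show "\<exists>C. \<forall>n. u n \<le> C * t ^ n"
    by blast
qed

text \<open>
  The estimate over one period of length \<open>m\<close> is iterated, with the constant chosen so that it covers
  the first \<open>m\<close> terms.
\<close>

lemma exp_growth_le_root:
  assumes "0 < m" and pos: "\<And>n. 0 < u n" and step: "\<And>n. u (m + n) \<le> a * u n"
  shows "exp_growth_le (root m a) u"
proof -
  have "0 < a * u 0"
    using pos step by (meson less_le_trans)
  then have "0 < a"
    using pos[of 0] by (simp add: zero_less_mult_iff)
  define s where "s = root m a"
  have s: "0 < s" "s ^ m = a"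
    using \<open>0 < a\<close> \<open>0 < m\<close> by (simp_all add: s_def)
  define C where "C = (\<Sum>j<m. u j / s ^ j)"
  have nonneg: "0 \<le> u j / s ^ j" for j
    using s(1) pos[of j] by simp
  then have "0 \<le> C"
    unfolding C_def by (rule sum_nonneg)
  have "u n \<le> C * s ^ n" for n
  proof (induction n rule: less_induct)
    case (less n)
    show ?case
    proof (cases "n < m")
      case True
      then have "u n / s ^ n \<le> C"
        unfolding C_def using nonneg by (intro member_le_sum) auto
      then show ?thesis
        using s by (simp add: divide_simps)
    next
      case False
      then have "u n \<le> a * u (n - m)"
        using step[of "n - m"] by simp
      also have "\<dots> \<le> a * (C * s ^ (n - m))"
        using False \<open>0 < m\<close> \<open>0 < a\<close> by (intro mult_left_mono less.IH) auto
      also have "\<dots> = C * s ^ n"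
        using False s(2) power_add[of s m "n - m"] by simp
      finally show ?thesis .
    qed
  qed
  with s(1) \<open>0 \<le> C\<close> show ?thesis
    unfolding s_def[symmetric] by (intro exp_growth_le_geometric) auto
qed

text \<open>
  The intended \<open>a n\<close> is the supremum of the ratios \<open>u (n + k) / u k\<close>. One inequality is the
  hypothesis on the growth of \<open>a\<close>. The other holds term by term and not just in the limit:
  \<open>\<rho> \<le> root n (a n)\<close> for every \<open>n > 0\<close>, by the iteration in \<open>exp_growth_le_root\<close>.
\<close>

lemma root_of_ratio_bound_tendsto:
  assumes pos: "\<And>n. 0 < u n" and step: "\<And>n k. u (n + k) \<le> a n * u k"
    and limsup: "limsup (\<lambda>n. ereal (root n (u n))) = ereal \<rho>"
    and "0 \<le> \<rho>" and growth: "exp_growth_le \<rho> a"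
  shows "(\<lambda>n. ereal (root n (a n))) \<longlonglongrightarrow> limsup (\<lambda>n. ereal (root n (u n)))"
proof -
  have a: "0 \<le> a n" for n
    using less_le_trans[OF pos step[of n 0]] pos[of 0] by (simp add: zero_less_mult_iff)
  have "ereal \<rho> \<le> ereal (root n (a n))" if "0 < n" for n
  proof -
    have "exp_growth_le (root n (a n)) u"
      using that pos step by (rule exp_growth_le_root)
    then show ?thesis
      using exp_growth_le_iff_limsup[of "root n (a n)" u] a pos limsup
      by (simp add: less_imp_le real_root_pos_pos_le)
  qed
  then have "\<forall>\<^sub>F n in sequentially. ereal \<rho> \<le> ereal (root n (a n))"
    by (rule eventually_mono[OF eventually_gt_at_top[of 0]])
  then have "ereal \<rho> \<le> liminf (\<lambda>n. ereal (root n (a n)))"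
    by (rule Liminf_bounded)
  moreover have "limsup (\<lambda>n. ereal (root n (a n))) \<le> ereal \<rho>"
    using growth exp_growth_le_iff_limsup[OF \<open>0 \<le> \<rho>\<close> a] by simp
  moreover have "liminf (\<lambda>n. ereal (root n (a n))) \<le> limsup (\<lambda>n. ereal (root n (a n)))"
    by (rule Liminf_le_Limsup) simp
  ultimately show ?thesis
    unfolding limsup by (intro Liminf_eq_Limsup) auto
qed

section \<open>The uniform boundedness principle\<close>

text \<open>
  The sets on which all \<open>T i\<close> are bounded by \<open>n\<close> are closed and cover the space, so by the theorem
  of Baire one of them contains a ball; a difference of two of its points reaches every direction.
\<close>

lemma uniform_boundedness:
  fixes T :: "nat \<Rightarrow> 'a::banach \<Rightarrow> 'b::real_normed_vector"
  assumes T: "\<And>i. bounded_linear (T i)" and pointwise: "\<And>x. \<exists>C. \<forall>i. norm (T i x) \<le> C"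
  shows "\<exists>C. \<forall>i x. norm (T i x) \<le> C * norm x"
proof -
  define E where "E n = {x. \<forall>i. norm (T i x) \<le> real n}" for n
  have closed: "closed (E n)" for n
  proof -
    have "closed {x. norm (T i x) \<le> real n}" for i
      by (intro closed_Collect_le continuous_intros linear_continuous_on T)
    then show ?thesis
      unfolding E_def by (intro closed_Collect_all) auto
  qed
  have "\<exists>n. x \<in> E n" for x
  proof -
    obtain C where "\<And>i. norm (T i x) \<le> C"
      using pointwise by blast
    moreover obtain n where "C \<le> real n"
      using real_arch_simple by blast
    ultimately show ?thesis
      unfolding E_def by (auto intro: order_trans)
  qed
  then have cover: "\<Union> (range E) = UNIV"
    by blast
  have "\<exists>n. interior (E n) \<noteq> {}"
  proof (rule ccontr)
    assume "\<nexists>n. interior (E n) \<noteq> {}"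
    then have "interior (\<Union> (range E)) = {}"
      using Met_TC.metric_Baire_category_alt[of "range E"] closed
      by (auto simp: complete_UNIV)
    then show False
      using cover by simp
  qed
  then obtain n a where "a \<in> interior (E n)"
    by blast
  then obtain r where r: "0 < r" "ball a r \<subseteq> E n"
    by (meson interior_subset open_contains_ball open_interior order_trans)
  \<comment> \<open>Translating the ball to the origin costs a factor 2.\<close>
  have small: "norm (T i x) \<le> 2 * real n" if "norm x < r" for i x
  proof -
    have "a + x \<in> E n" "a \<in> E n"
      using r that by (auto simp: dist_norm)
    then have "norm (T i (a + x) - T i a) \<le> 2 * real n"
      using norm_triangle_ineq4[of "T i (a + x)" "T i a"]
      unfolding E_def mem_Collect_eq by (smt (verit))
    then show ?thesis
      by (simp add: linear_add[OF bounded_linear.linear[OF T]])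
  qed
  have "norm (T i x) \<le> (4 * real n / r) * norm x" for i x
  proof (cases "x = 0")
    case True
    then show ?thesis
      by (simp add: linear_0[OF bounded_linear.linear[OF T]])
  next
    case False
    let ?c = "r / (2 * norm x)"
    have "norm (T i (?c *\<^sub>R x)) \<le> 2 * real n"
      using False r by (intro small) simp
    then have "?c * norm (T i x) \<le> 2 * real n"
      using r False by (simp add: linear_scale[OF bounded_linear.linear[OF T]])
    then show ?thesis
      using r False by (simp add: divide_simps mult_ac)
  qed
  then show ?thesis
    by blast
qed


section \<open>Neumann series and local spectra\<close>

lemma bounded_linear_scaleC_right: "bounded_linear (\<lambda>x. c *\<^sub>C (x :: 'a::complex_hilbert))"
  by (rule bounded_linear_intro[where K = "cmod c"])
    (simp_all add: scaleC_add_right scaleR_scaleC scaleC_scaleC norm_scaleC mult.commute)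

lemma bounded_linear_scaleC_left: "bounded_linear (\<lambda>c. c *\<^sub>C (x :: 'a::complex_hilbert))"
  by (rule bounded_linear_intro[where K = "norm x"])
    (simp_all add: scaleC_add_left scaleR_scaleC scaleC_scaleC norm_scaleC scaleR_conv_of_real)

lemmas scaleC_zero_right [simp] = linear_0[OF bounded_linear.linear[OF bounded_linear_scaleC_right]]
  and scaleC_zero_left [simp] = linear_0[OF bounded_linear.linear[OF bounded_linear_scaleC_left]]
  and scaleC_minus_right = linear_neg[OF bounded_linear.linear[OF bounded_linear_scaleC_right]]
  and scaleC_diff_right = linear_diff[OF bounded_linear.linear[OF bounded_linear_scaleC_right]]
  and scaleC_sum_right = linear_sum[OF bounded_linear.linear[OF bounded_linear_scaleC_right]]
  and scaleC_minus_left = linear_neg[OF bounded_linear.linear[OF bounded_linear_scaleC_left]]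

text \<open>
  Near a point of modulus above \<open>\<rho>\<close> the variable keeps its modulus above some \<open>s > \<rho>\<close>. The series
  of derivatives then has a geometric majorant with ratio \<open>t / s\<close>, up to the factor \<open>Suc n\<close>, for
  any \<open>t\<close> strictly between \<open>\<rho>\<close> and \<open>s\<close>, so termwise differentiation is justified.
\<close>

lemma vector_analytic_on_inverse_power_series:
  fixes v :: "nat \<Rightarrow> 'a::complex_hilbert"
  assumes "0 \<le> \<rho>" and growth: "exp_growth_le \<rho> (\<lambda>n. norm (v n))"
  defines "g \<equiv> \<lambda>n z. inverse z ^ Suc n *\<^sub>C v n"
  shows "vector_analytic_on (\<lambda>z. - (\<Sum>n. g n z)) {z. \<rho> < cmod z}"
    and "\<rho> < cmod z \<Longrightarrow> summable (\<lambda>n. g n z)"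
proof -
  define D where "D n z = - (of_nat (Suc n) * inverse z ^ (n + 2))" for n and z :: complex
  have main: "summable (\<lambda>n. g n z0) \<and> (\<exists>d. ((\<lambda>z. - (\<Sum>n. g n z)) has_derivative (\<lambda>h. h *\<^sub>C d)) (at z0))"
    if z0_far: "\<rho> < cmod z0" for z0
  proof -
    obtain s where s: "\<rho> < s" "s < cmod z0"
      using dense[OF z0_far] by blast
    then obtain t where t: "\<rho> < t" "t < s"
      using dense[OF s(1)] by blast
    obtain C where C: "\<And>n. norm (v n) \<le> C * t ^ n"
      using exp_growth_leD[OF growth t(1)] by blast
    have "0 < t" "0 < s"
      using assms(1) t by auto
    have "0 \<le> C"
      using order_trans[OF norm_ge_zero C[of 0]] by simp
    \<comment> \<open>The radius is such that the ball keeps distance \<open>s\<close> from the pole at 0.\<close>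
    define U where "U = ball z0 (cmod z0 - s)"
    have far: "s < cmod z" if "z \<in> U" for z
      using that norm_triangle_ineq2[of z0 z] by (auto simp: U_def dist_norm)
    have inv: "cmod (inverse z) \<le> inverse s" if "z \<in> U" for z
      using far[OF that] \<open>0 < s\<close> by (simp add: norm_inverse le_imp_inverse_le)
    have z0: "z0 \<in> U"
      using s by (simp add: U_def)
    have der: "((g n) has_derivative (\<lambda>h. (h * D n z) *\<^sub>C v n)) (at z within U)" if "z \<in> U" for n z
    proof -
      have "z \<noteq> 0"
        using far[OF that] \<open>0 < s\<close> by auto
      then have "((\<lambda>z. inverse z ^ Suc n) has_field_derivative D n z) (at z within U)"
        using DERIV_power_Suc[OF DERIV_inverse, of z n U]
        by (simp add: D_def power_add power2_eq_square mult_ac)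
      then have "((\<lambda>z. inverse z ^ Suc n) has_derivative (\<lambda>h. h * D n z)) (at z within U)"
        by (simp add: has_field_derivative_def mult_commute_abs)
      then show ?thesis
        unfolding g_def by (rule bounded_linear.has_derivative[OF bounded_linear_scaleC_left])
    qed
    have "summable (\<lambda>n. (inverse s)\<^sup>2 * C * (of_nat (Suc n) * (t / s) ^ n))"
      using t \<open>0 < t\<close> by (intro summable_mult sums_summable[OF geometric_deriv_sums]) simp
    moreover have "norm (D n z *\<^sub>C v n) \<le> (inverse s)\<^sup>2 * C * (of_nat (Suc n) * (t / s) ^ n)"
      if "z \<in> U" for n z
    proof -
      have "cmod (D n z) = of_nat (Suc n) * cmod (inverse z) ^ (n + 2)"
        by (simp only: D_def norm_minus_cancel norm_mult norm_of_nat norm_power)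
      also have "\<dots> \<le> of_nat (Suc n) * inverse s ^ (n + 2)"
        by (intro mult_left_mono power_mono inv that) auto
      finally have "norm (D n z *\<^sub>C v n) \<le> (of_nat (Suc n) * inverse s ^ (n + 2)) * (C * t ^ n)"
        unfolding norm_scaleC using C[of n] \<open>0 < s\<close> by (intro mult_mono) auto
      also have "\<dots> = (inverse s)\<^sup>2 * C * (of_nat (Suc n) * (t / s) ^ n)"
        by (simp add: power_add power_divide divide_inverse power_inverse power_mult_distrib power2_eq_square)
      finally show ?thesis .
    qed
    ultimately have unif: "uniform_limit U (\<lambda>n z. \<Sum>i<n. D i z *\<^sub>C v i)
        (\<lambda>z. \<Sum>i. D i z *\<^sub>C v i) sequentially"
      by (intro Weierstrass_m_test)
    have "summable (\<lambda>n. inverse s * C * (t / s) ^ n)"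
      using t \<open>0 < t\<close> by (intro summable_mult summable_geometric) simp
    moreover have "norm (g n z0) \<le> inverse s * C * (t / s) ^ n" for n
    proof -
      have "norm (g n z0) \<le> inverse s ^ Suc n * (C * t ^ n)"
        unfolding g_def norm_scaleC norm_power using C[of n] \<open>0 < s\<close>
        by (intro mult_mono power_mono inv z0) auto
      also have "\<dots> = inverse s * C * (t / s) ^ n"
        by (simp add: power_divide divide_inverse power_inverse power_mult_distrib)
      finally show ?thesis .
    qed
    ultimately have summable: "summable (\<lambda>n. g n z0)"
      by (rule summable_comparison_test'[where N = 0]) 
    have "\<exists>G. \<forall>z\<in>U. (\<lambda>n. g n z) sums G z \<and>
        (G has_derivative (\<lambda>h. h *\<^sub>C (\<Sum>i. D i z *\<^sub>C v i))) (at z within U)"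
    proof (rule has_derivative_series[OF _ der _ z0 summable_sums[OF summable]])
      show "convex U"
        by (simp add: U_def)
      fix e :: real assume "0 < e"
      then have "\<forall>\<^sub>F n in sequentially. \<forall>z\<in>U.
          dist (\<Sum>i<n. D i z *\<^sub>C v i) (\<Sum>i. D i z *\<^sub>C v i) < e"
        using unif by (simp add: uniform_limit_iff)
      then show "\<forall>\<^sub>F n in sequentially. \<forall>z\<in>U. \<forall>h.
          norm ((\<Sum>i<n. (h * D i z) *\<^sub>C v i) - h *\<^sub>C (\<Sum>i. D i z *\<^sub>C v i)) \<le> e * norm h"
      proof eventually_elim
        case (elim n)
        have "norm ((\<Sum>i<n. (h * D i z) *\<^sub>C v i) - h *\<^sub>C (\<Sum>i. D i z *\<^sub>C v i))
            = norm h * dist (\<Sum>i<n. D i z *\<^sub>C v i) (\<Sum>i. D i z *\<^sub>C v i)" for h z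
          by (simp add: scaleC_scaleC[symmetric] scaleC_sum_right[symmetric]
              scaleC_diff_right[symmetric] norm_scaleC dist_norm)
        then show ?case
          using elim by (auto intro!: mult_left_mono simp: mult.commute[of e] less_imp_le)
      qed
    qed
    then obtain G where G: "\<And>z. z \<in> U \<Longrightarrow> (\<lambda>n. g n z) sums G z"
      and dG: "(G has_derivative (\<lambda>h. h *\<^sub>C (\<Sum>i. D i z0 *\<^sub>C v i))) (at z0 within U)"
      using z0 by blast
    have "((\<lambda>z. - G z) has_derivative (\<lambda>h. h *\<^sub>C (- (\<Sum>i. D i z0 *\<^sub>C v i)))) (at z0)"
      using has_derivative_minus[OF dG] z0
      by (simp add: scaleC_minus_right at_within_open[OF _ open_ball] U_def)
    then have "((\<lambda>z. - (\<Sum>n. g n z)) has_derivative (\<lambda>h. h *\<^sub>C (- (\<Sum>i. D i z0 *\<^sub>C v i)))) (at z0)"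
      by (rule has_derivative_transform_within_open[where s = U])
        (use z0 G in \<open>auto simp: U_def sums_unique\<close>)
    with summable show ?thesis
      by blast
  qed
  show "vector_analytic_on (\<lambda>z. - (\<Sum>n. g n z)) {z. \<rho> < cmod z}"
    unfolding vector_analytic_on_def using main by simp
  show "\<rho> < cmod z \<Longrightarrow> summable (\<lambda>n. g n z)"
    using main by simp
qed

text \<open>
  The witness is the Neumann series \<open>- (\<Sum>n. inverse \<mu> ^ (n + 1) (T ^ n) y)\<close>. It solves
  \<open>(T - \<mu>) f = y\<close> by telescoping, and it converges as soon as the orbit of this one
  vector grows slowly enough, even where \<open>\<mu>\<close> belongs to the spectrum of \<open>T\<close>.
\<close>

lemma local_spectrum_subset_cball:
  assumes T: "bounded_clinear T" and "0 \<le> \<rho>"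
    and growth: "exp_growth_le \<rho> (\<lambda>n. norm ((T ^^ n) y))"
  shows "local_spectrum T y \<subseteq> cball 0 \<rho>"
proof -
  let ?U = "{z. \<rho> < cmod z}"
  let ?g = "\<lambda>n z. inverse z ^ Suc n *\<^sub>C (T ^^ n) y"
  let ?f = "\<lambda>z. - (\<Sum>n. ?g n z)"
  have lin: "bounded_linear T" and scaleC: "T (c *\<^sub>C x) = c *\<^sub>C T x" for c x
    using T by (auto simp: bounded_clinear_def)
  have eq: "T (?f z) - z *\<^sub>C ?f z = y" if "z \<in> ?U" for z
  proof -
    have "z \<noteq> 0"
      using that \<open>0 \<le> \<rho>\<close> by auto
    have G: "(\<lambda>n. ?g n z) sums (\<Sum>n. ?g n z)"
      using vector_analytic_on_inverse_power_series(2)[OF \<open>0 \<le> \<rho>\<close> growth] that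
      by (intro summable_sums) simp
    from bounded_linear.sums[OF lin G]
    have "(\<lambda>n. inverse z ^ Suc n *\<^sub>C (T ^^ Suc n) y) sums T (\<Sum>n. ?g n z)"
      by (simp add: scaleC)
    then have "(\<lambda>n. inverse z ^ n *\<^sub>C (T ^^ n) y) sums (T (\<Sum>n. ?g n z) + y)"
      by (subst (asm) sums_Suc_iff) simp
    moreover have "(\<lambda>n. inverse z ^ n *\<^sub>C (T ^^ n) y) sums (z *\<^sub>C (\<Sum>n. ?g n z))"
      using bounded_linear.sums[OF bounded_linear_scaleC_right[of z] G] \<open>z \<noteq> 0\<close>
      by (simp add: scaleC_scaleC mult.assoc[symmetric])
    ultimately have "T (\<Sum>n. ?g n z) + y = z *\<^sub>C (\<Sum>n. ?g n z)"
      by (rule sums_unique2)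
    then show ?thesis
      by (simp add: linear_neg[OF bounded_linear.linear[OF lin]] scaleC_minus_right algebra_simps)
  qed
  have "open ?U"
    by (intro open_Collect_less continuous_intros)
  then have "?U \<subseteq> local_resolvent_set T y"
    unfolding local_resolvent_set_def
    using vector_analytic_on_inverse_power_series(1)[OF \<open>0 \<le> \<rho>\<close> growth] eq by blast
  then show ?thesis
    by (auto simp: local_spectrum_def not_less[symmetric])
qed

section \<open>Coordinates in the Hilbert sum\<close>

lift_definition single :: "nat \<Rightarrow> 'h::real_normed_vector \<Rightarrow> 'h hilbert_sum"
  is "\<lambda>k v n. if n = k then v else 0"
  by (rule summable_finite[of "{k}" for k]) auto

lift_definition truncate :: "nat \<Rightarrow> 'h::real_normed_vector hilbert_sum \<Rightarrow> 'h hilbert_sum"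
  is "\<lambda>N x n. if n < N then x n else 0"
  by (rule summable_finite[of "{..<N}" for N]) auto

lemma norm_single [simp]: "norm (single k v) = norm v"
proof -
  have "(\<Sum>n. (norm (coord (single k v) n))\<^sup>2) = (norm v)\<^sup>2"
    by (subst suminf_finite[of "{k}"]) (auto simp: single.rep_eq)
  then show ?thesis
    by (simp add: norm_hilbert_sum_def)
qed

lemma truncate_0 [simp]: "truncate 0 x = 0"
  by (rule hilbert_sum_eqI) (simp add: truncate.rep_eq)

lemma truncate_Suc: "truncate (Suc N) x = truncate N x + single N (coord x N)"
  by (rule hilbert_sum_eqI) (simp add: truncate.rep_eq single.rep_eq less_Suc_eq)

lemma norm_truncate_squared: "(norm (truncate N x))\<^sup>2 = (\<Sum>n<N. (norm (coord x n))\<^sup>2)"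
  unfolding norm_squared_hilbert_sum
  by (subst suminf_finite[of "{..<N}"]) (auto simp: truncate.rep_eq)

lemma norm_truncate_le: "norm (truncate N x) \<le> norm x"
  by (rule power2_le_imp_le) (simp_all add: norm_truncate_squared partial_sum_le_norm)

lemma truncate_tendsto: "(\<lambda>N. truncate N x) \<longlonglongrightarrow> x"
proof -
  \<comment> \<open>Head and tail of the sequence are orthogonal.\<close>
  have pyth: "(norm (truncate N x - x))\<^sup>2 = (norm x)\<^sup>2 - (\<Sum>n<N. (norm (coord x n))\<^sup>2)" for N
  proof -
    have "(norm (truncate N x - x))\<^sup>2
        = (\<Sum>n. (norm (coord x n))\<^sup>2 - (norm (coord (truncate N x) n))\<^sup>2)"
      unfolding norm_squared_hilbert_sum by (rule suminf_cong) (simp add: truncate.rep_eq)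
    also have "\<dots> = (norm x)\<^sup>2 - (norm (truncate N x))\<^sup>2"
      by (simp add: norm_squared_hilbert_sum suminf_diff summable_coord)
    finally show ?thesis
      by (simp add: norm_truncate_squared)
  qed
  have "(\<lambda>N. \<Sum>n<N. (norm (coord x n))\<^sup>2) \<longlonglongrightarrow> (norm x)\<^sup>2"
    unfolding norm_squared_hilbert_sum by (intro summable_LIMSEQ summable_coord)
  from tendsto_diff[OF tendsto_const this, of "(norm x)\<^sup>2"]
  have "(\<lambda>N. (norm (truncate N x - x))\<^sup>2) \<longlonglongrightarrow> 0"
    by (simp add: pyth)
  from tendsto_real_sqrt[OF this] show ?thesis
    by (simp add: LIM_zero_iff tendsto_norm_zero_iff)
qed

text \<open>
  For non-zero \<open>e n\<close> this is the isometric embedding of the real square-summable sequences onto the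
  real closed span of the vectors \<open>e n\<close>, each placed in its own coordinate. It makes that subspace
  the image of a Banach space, as the uniform boundedness principle needs.
\<close>

lift_definition unit_combination :: "(nat \<Rightarrow> 'h::real_normed_vector) \<Rightarrow> real hilbert_sum \<Rightarrow> 'h hilbert_sum"
  is "\<lambda>e c n. c n *\<^sub>R sgn (e n)"
proof -
  fix e :: "nat \<Rightarrow> 'h" and c :: "nat \<Rightarrow> real"
  assume "summable (\<lambda>n. (norm (c n))\<^sup>2)"
  then show "summable (\<lambda>n. (norm (c n *\<^sub>R sgn (e n)))\<^sup>2)"
    by (rule summable_comparison_test'[where N = 0])
      (simp add: norm_sgn)
qed

lemma bounded_linear_unit_combination: "bounded_linear (unit_combination e)"
proof (rule bounded_linear_intro[where K = 1])
  show "unit_combination e (c + d) = unit_combination e c + unit_combination e d" for c d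
    by (rule hilbert_sum_eqI) (simp add: unit_combination.rep_eq scaleR_add_left)
  show "unit_combination e (r *\<^sub>R c) = r *\<^sub>R unit_combination e c" for r c
    by (rule hilbert_sum_eqI) (simp add: unit_combination.rep_eq)
  show "norm (unit_combination e c) \<le> norm c * 1" for c
  proof -
    have "(\<Sum>n. (norm (coord (unit_combination e c) n))\<^sup>2) \<le> (\<Sum>n. (norm (coord c n))\<^sup>2)"
      by (intro suminf_le summable_coord) (simp add: unit_combination.rep_eq norm_sgn)
    then show ?thesis
      by (simp add: norm_hilbert_sum_def)
  qed
qed


section \<open>The equation of the resolvent for a shift with invertible weights\<close>

locale invertible_weighted_shift =
  fixes A :: "nat \<Rightarrow> 'h::complex_hilbert \<Rightarrow> 'h"
  assumes weights: "uniformly_bounded_weights A"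
    and invertible: "invertible_op (A n)"
begin

abbreviation S :: "'h hilbert_sum \<Rightarrow> 'h hilbert_sum"
  where "S \<equiv> unilateral_shift A"

abbreviation B :: "nat \<Rightarrow> 'h \<Rightarrow> 'h"
  where "B \<equiv> weight_product A"

lemma bounded_linear_weight: "bounded_linear (A n)"
  and weight_scaleC: "A n (c *\<^sub>C x) = c *\<^sub>C A n x"
  using weights by (auto simp: uniformly_bounded_weights_def bounded_clinear_def)

lemmas weight_zero [simp] = linear_0[OF bounded_linear.linear[OF bounded_linear_weight]]
  and weight_minus = linear_neg[OF bounded_linear.linear[OF bounded_linear_weight]]
  and weight_scaleR = linear_scale[OF bounded_linear.linear[OF bounded_linear_weight]]

lemma bij_weight: "bij (A n)"
proof -
  obtain R where "R \<circ> A n = id" "A n \<circ> R = id"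
    using invertible[of n] unfolding invertible_op_def by blast
  then show ?thesis
    by (rule o_bij)
qed

lemma bij_weight_product: "bij (B n)"
  by (induction n) (simp_all only: weight_product.simps bij_id bij_comp bij_weight)

lemma weight_product_scaleR: "B n (r *\<^sub>R x) = r *\<^sub>R B n x"
  by (induction n) (simp_all add: weight_scaleR)

lemma weight_product_zero [simp]: "B n 0 = 0"
  using weight_product_scaleR[of n 0 0] by simp

lemma weight_product_eq_0_iff [simp]: "B n x = 0 \<longleftrightarrow> x = 0"
  using injD[OF bij_is_inj[OF bij_weight_product[of n]], of x 0] by auto

lemma bounded_linear_shift: "bounded_linear S"
  and shift_scaleC: "S (c *\<^sub>C f) = c *\<^sub>C S f"
  using bounded_clinear_unilateral_shift[OF weights] by (auto simp: bounded_clinear_def)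

lemmas shift_add = linear_add[OF bounded_linear.linear[OF bounded_linear_shift]]

lemma shift_minus_scalar_add:
  "S (f + g) - \<mu> *\<^sub>C (f + g) = (S f - \<mu> *\<^sub>C f) + (S g - \<mu> *\<^sub>C g)"
  by (simp only: shift_add scaleC_add_right add_diff_add)

lemma shift_minus_scalar_scaleC:
  "S (c *\<^sub>C f) - \<mu> *\<^sub>C (c *\<^sub>C f) = c *\<^sub>C (S f - \<mu> *\<^sub>C f)"
  by (simp only: shift_scaleC scaleC_diff_right scaleC_scaleC mult.commute)

lemma coord_shift:
  shows "coord (S f) 0 = 0" and "coord (S f) (Suc n) = A n (coord f n)"
  by (simp_all add: coord_unilateral_shift[OF weights])

lemma shift_single: "S (single k v) = single (Suc k) (A k v)"
proof (rule hilbert_sum_eqI)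
  show "coord (S (single k v)) n = coord (single (Suc k) (A k v)) n" for n
    by (cases n) (simp_all add: coord_shift single.rep_eq)
qed

lemma shift_power_single: "(S ^^ n) (single k (B k x)) = single (k + n) (B (k + n) x)"
  by (induction n) (simp_all add: shift_single)

text \<open>
  A shift has no term in coordinate \<open>0\<close>, so the equation determines the coordinates of a solution one
  after the other. Uniqueness of solutions and the formula for the solutions rest on this recursion.
\<close>

lemma coord_solution:
  assumes "\<mu> \<noteq> 0" and eq: "S f - \<mu> *\<^sub>C f = y"
  shows "coord f 0 = - inverse \<mu> *\<^sub>C coord y 0"
    and "coord f (Suc n) = inverse \<mu> *\<^sub>C (A n (coord f n) - coord y (Suc n))"
proof -
  have eq': "\<mu> *\<^sub>C coord f n = coord (S f) n - coord y n" for n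
    unfolding eq[symmetric] by simp
  have *: "coord f n = inverse \<mu> *\<^sub>C (coord (S f) n - coord y n)" for n
    using arg_cong[OF eq'[of n], of "\<lambda>v. inverse \<mu> *\<^sub>C v"] assms(1) by (simp add: scaleC_scaleC)
  from *[of 0] show "coord f 0 = - inverse \<mu> *\<^sub>C coord y 0"
    by (simp add: coord_shift scaleC_minus_left scaleC_minus_right)
  from *[of "Suc n"] show "coord f (Suc n) = inverse \<mu> *\<^sub>C (A n (coord f n) - coord y (Suc n))"
    by (simp add: coord_shift)
qed

lemma solution_unique:
  assumes "\<mu> \<noteq> 0" and "S f - \<mu> *\<^sub>C f = S g - \<mu> *\<^sub>C g"
  shows "f = g"
proof (rule hilbert_sum_eqI)
  show "coord f n = coord g n" for n
    by (induction n)
      (simp_all only: coord_solution[OF assms(1) refl, of f] coord_solution[OF assms(1) refl, of g] assms(2))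
qed

text \<open>
  The recursion, started at coordinate \<open>k\<close>, multiplies by the next weight and by \<open>inverse \<mu>\<close> in every step.
\<close>

lemma norm_solution_coord:
  assumes "\<mu> \<noteq> 0" and "S f - \<mu> *\<^sub>C f = single k (B k x)"
  shows "norm (B (k + n) x) = cmod \<mu> ^ Suc n * norm (coord f (k + n))"
proof -
  note sol = coord_solution[OF assms]
  have "coord f n = (if n < k then 0 else - (inverse \<mu> ^ Suc (n - k)) *\<^sub>C B n x)" for n
  proof (induction n)
    case 0
    show ?case
      by (simp add: sol single.rep_eq)
  next
    case (Suc n)
    then show ?case
      by (cases "Suc n < k"; cases "Suc n = k")
        (auto simp: sol(2) single.rep_eq weight_minus weight_scaleC scaleC_scaleC scaleC_minus_left
          scaleC_minus_right Suc_diff_le)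
  qed
  then have "coord f (k + n) = - (inverse \<mu> ^ Suc n) *\<^sub>C B (k + n) x"
    by simp
  then have "norm (coord f (k + n)) = inverse (cmod \<mu>) ^ Suc n * norm (B (k + n) x)"
    by (simp only: norm_scaleC norm_minus_cancel norm_power norm_inverse)
  then show ?thesis
    using assms(1) by (simp add: power_inverse divide_simps mult.commute del: power_Suc)
qed

text \<open>
  Each truncation of \<open>y\<close> is a finite sum of vectors whose orbits have rate at most \<open>\<rho>\<close>, so the Neumann
  series applies to it. That series may diverge for \<open>y\<close> itself; condition (C) carries
  the inclusion of local spectra over to the limit.
\<close>

lemma local_spectrum_subset_cball_of_coords:
  assumes C: "dunford_condition_C S" and "0 \<le> \<rho>"
    and coords: "\<And>k. \<exists>x. coord y k = B k x \<and> exp_growth_le \<rho> (\<lambda>n. norm (B n x))"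
  shows "local_spectrum S y \<subseteq> cball 0 \<rho>"
proof -
  let ?E = "{x. local_spectrum S x \<subseteq> cball 0 \<rho>}"
  have "exp_growth_le \<rho> (\<lambda>n. norm ((S ^^ n) (truncate N y)))" for N
  proof (induction N)
    case 0
    have "(S ^^ n) 0 = 0" for n
      by (induction n) (simp_all add: linear_0[OF bounded_linear.linear[OF bounded_linear_shift]])
    then show ?case
      using \<open>0 \<le> \<rho>\<close> by (simp add: exp_growth_le_zero)
  next
    case (Suc N)
    obtain x where x: "coord y N = B N x" "exp_growth_le \<rho> (\<lambda>n. norm (B n x))"
      using coords by blast
    have add: "(S ^^ n) (u + v) = (S ^^ n) u + (S ^^ n) v" for n u v
      by (induction n) (simp_all add: shift_add)
    have "norm ((S ^^ n) (truncate (Suc N) y))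
        \<le> norm ((S ^^ n) (truncate N y)) + norm (B (N + n) x)" for n
      using norm_triangle_ineq[of "(S ^^ n) (truncate N y)" "single (N + n) (B (N + n) x)"]
      by (simp add: truncate_Suc add x(1) shift_power_single)
    then show ?case
      by (rule exp_growth_le_mono[OF exp_growth_le_add[OF Suc.IH exp_growth_le_shift[OF x(2)]]])
  qed
  then have truncations: "truncate N y \<in> ?E" for N
    using local_spectrum_subset_cball[OF bounded_clinear_unilateral_shift[OF weights] \<open>0 \<le> \<rho>\<close>]
    by blast
  have "closed ?E"
    using C closed_cball unfolding dunford_condition_C_def by blast
  then have "y \<in> ?E"
    using truncations truncate_tendsto by (rule closed_sequentially)
  then show ?thesis
    by simp
qed

lemma solution_exists:
  assumes "local_spectrum S y \<subseteq> cball 0 \<rho>" and "\<rho> < cmod \<mu>"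
  obtains f where "S f - \<mu> *\<^sub>C f = y"
proof -
  have "\<mu> \<in> local_resolvent_set S y"
    using assms by (auto simp: local_spectrum_def)
  then show thesis
    using that unfolding local_resolvent_set_def by blast
qed

text \<open>
  The solution operator \<open>G\<close> is linear by uniqueness. By the recursion each coordinate of \<open>G c\<close>, hence
  each truncation, is a bounded linear function of \<open>c\<close>, though with bounds that may increase with the
  length. The truncations of \<open>G c\<close> have norm at most that of \<open>G c\<close>, so the uniform boundedness
  principle gives one bound for all of them. The map \<open>\<Phi>\<close> selects the right-hand sides for which the
  equation is known to be solvable; its domain supplies the completeness.
\<close>

lemma solution_bounded:
  fixes \<Phi> :: "'x::banach \<Rightarrow> 'h hilbert_sum"
  assumes "\<mu> \<noteq> 0" and \<Phi>: "bounded_linear \<Phi>" and ex: "\<And>c. \<exists>f. S f - \<mu> *\<^sub>C f = \<Phi> c"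
  shows "\<exists>K. \<forall>c f. S f - \<mu> *\<^sub>C f = \<Phi> c \<longrightarrow> norm f \<le> K * norm c"
proof -
  obtain G where G: "\<And>c. S (G c) - \<mu> *\<^sub>C G c = \<Phi> c"
    using ex by metis
  note sol = coord_solution[OF assms(1) G]
  have add: "G (c + d) = G c + G d" for c d
    by (rule solution_unique[OF assms(1)])
      (simp only: shift_minus_scalar_add G linear_add[OF bounded_linear.linear[OF \<Phi>]])
  have scale: "G (r *\<^sub>R c) = r *\<^sub>R G c" for r c
    by (rule solution_unique[OF assms(1)])
      (simp only: scaleR_scaleC[of r "G c"] shift_minus_scalar_scaleC G
        linear_scale[OF bounded_linear.linear[OF \<Phi>]] scaleR_scaleC[of r "\<Phi> c"])
  obtain M where M: "0 \<le> M" "\<And>n v. norm (A n v) \<le> M * norm v"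
    using uniformly_bounded_weightsE[OF weights] by blast
  obtain L where L: "\<And>c. norm (\<Phi> c) \<le> norm c * L"
    using bounded_linear.bounded[OF \<Phi>] by blast
  have coord_\<Phi>: "norm (coord (\<Phi> c) n) \<le> norm c * L" for c n
    using norm_coord_le L by (rule order_trans)
  have coord_bounded: "\<exists>K. \<forall>c. norm (coord (G c) n) \<le> norm c * K" for n
  proof (induction n)
    case 0
    have "norm (coord (G c) 0) \<le> norm c * (cmod (inverse \<mu>) * L)" for c
      using mult_left_mono[OF coord_\<Phi>[of c 0], of "cmod (inverse \<mu>)"]
      by (simp add: sol norm_scaleC mult_ac)
    then show ?case
      by blast
  next
    case (Suc n)
    then obtain K where K: "\<And>c. norm (coord (G c) n) \<le> norm c * K"
      by blast
    have "norm (coord (G c) (Suc n)) \<le> norm c * (cmod (inverse \<mu>) * (M * K + L))" for c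
    proof -
      have "norm (A n (coord (G c) n) - coord (\<Phi> c) (Suc n)) \<le> M * (norm c * K) + norm c * L"
        using M(2)[of n "coord (G c) n"] mult_left_mono[OF K[of c] M(1)] coord_\<Phi>[of c "Suc n"]
          norm_triangle_ineq4[of "A n (coord (G c) n)" "coord (\<Phi> c) (Suc n)"] by linarith
      from mult_left_mono[OF this, of "cmod (inverse \<mu>)"] show ?thesis
        by (simp add: sol(2) norm_scaleC algebra_simps)
    qed
    then show ?case
      by blast
  qed
  have "bounded_linear (\<lambda>c. truncate N (G c))" for N
  proof -
    have "\<exists>K. \<forall>c. norm (truncate N (G c)) \<le> norm c * K"
    proof (induction N)
      case 0
      show ?case
        by (auto intro: exI[of _ 0])
    next
      case (Suc N)
      then obtain K where K: "\<And>c. norm (truncate N (G c)) \<le> norm c * K"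
        by blast
      obtain K' where K': "\<And>c. norm (coord (G c) N) \<le> norm c * K'"
        using coord_bounded by blast
      have "norm (truncate (Suc N) (G c)) \<le> norm c * (K + K')" for c
        using norm_triangle_ineq[of "truncate N (G c)" "single N (coord (G c) N)"] K[of c] K'[of c]
        by (simp add: truncate_Suc distrib_left)
      then show ?case
        by blast
    qed
    then obtain K where "\<And>c. norm (truncate N (G c)) \<le> norm c * K"
      by blast
    then show ?thesis
      by (intro bounded_linear_intro[where K = K])
        (auto simp: add scale truncate.rep_eq intro!: hilbert_sum_eqI)
  qed
  moreover have "\<exists>K. \<forall>N. norm (truncate N (G c)) \<le> K" for c
    using norm_truncate_le by blast
  ultimately obtain K where K: "\<And>N c. norm (truncate N (G c)) \<le> K * norm c"
    using uniform_boundedness[of "\<lambda>N c. truncate N (G c)"] by blast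
  have "norm (G c) \<le> K * norm c" for c
    using LIMSEQ_le_const2[OF tendsto_norm[OF truncate_tendsto[of "G c"]]] K by blast
  moreover have "f = G c" if "S f - \<mu> *\<^sub>C f = \<Phi> c" for f c
    using solution_unique[OF assms(1)] that G by metis
  ultimately show ?thesis
    by blast
qed

section \<open>Spectral radius and rates of growth under condition (C)\<close>

text \<open>
  By surjectivity of \<open>B k\<close>, every vector in coordinate \<open>k\<close> has an orbit with rate at most \<open>\<rho>\<close>. Hence all
  right-hand sides are admissible, and \<open>solution_bounded\<close> with the identity for \<open>\<Phi>\<close> bounds the inverse.
\<close>

lemma resolvent_if_growth:
  assumes C: "dunford_condition_C S" and "0 \<le> \<rho>" and "\<rho> < cmod \<mu>"
    and growth: "\<And>x. exp_growth_le \<rho> (\<lambda>n. norm (B n x))"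
  shows "\<mu> \<notin> op_spectrum S"
proof -
  have "\<mu> \<noteq> 0"
    using assms(2,3) by auto
  have "\<exists>x. coord y k = B k x \<and> exp_growth_le \<rho> (\<lambda>n. norm (B n x))" for y k
    using growth bij_is_surj[OF bij_weight_product[of k]] by (meson surjD)
  then have "\<exists>f. S f - \<mu> *\<^sub>C f = y" for y
    using local_spectrum_subset_cball_of_coords[OF C \<open>0 \<le> \<rho>\<close>] solution_exists \<open>\<rho> < cmod \<mu>\<close>
    by metis
  then obtain G where G: "\<And>y. S (G y) - \<mu> *\<^sub>C G y = y"
    by metis
  have G_left: "G (S f - \<mu> *\<^sub>C f) = f" for f
    using solution_unique[OF \<open>\<mu> \<noteq> 0\<close>] G by blast
  obtain K where K: "\<And>y f. S f - \<mu> *\<^sub>C f = y \<Longrightarrow> norm f \<le> K * norm y"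
    using solution_bounded[OF \<open>\<mu> \<noteq> 0\<close>, of "\<lambda>y. y"] G bounded_linear_ident by blast
  have add: "G (y + z) = G y + G z" for y z
    by (rule solution_unique[OF \<open>\<mu> \<noteq> 0\<close>]) (simp only: shift_minus_scalar_add G)
  have scaleC: "G (c *\<^sub>C y) = c *\<^sub>C G y" for c y
    by (rule solution_unique[OF \<open>\<mu> \<noteq> 0\<close>]) (simp only: shift_minus_scalar_scaleC G)
  have "bounded_linear G"
    by (rule bounded_linear_intro[where K = K])
      (simp_all add: add scaleC scaleR_scaleC K[OF G] mult.commute[of _ K])
  then have "bounded_clinear G"
    by (simp add: bounded_clinear_def scaleC)
  moreover have "bounded_clinear (\<lambda>f. S f - \<mu> *\<^sub>C f)"
    unfolding bounded_clinear_def
    by (intro conjI allI bounded_linear_sub bounded_linear_shift bounded_linear_scaleC_right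
        shift_minus_scalar_scaleC)
  ultimately have "invertible_op (\<lambda>f. S f - \<mu> *\<^sub>C f)"
    unfolding invertible_op_def by (auto simp: fun_eq_iff G G_left intro!: exI[of _ G])
  then show ?thesis
    by (simp add: op_spectrum_def)
qed

text \<open>
  The preimage of \<open>x\<close> in coordinate \<open>0\<close> has bounded coordinates, and these are the vectors \<open>B n x\<close> up to
  powers of \<open>\<mu>\<close>.
\<close>

lemma growth_if_resolvent:
  assumes "\<mu> \<noteq> 0" and "\<mu> \<notin> op_spectrum S"
  shows "exp_growth_le (cmod \<mu>) (\<lambda>n. norm (B n x))"
proof -
  have "invertible_op (\<lambda>f. S f - \<mu> *\<^sub>C f)"
    using assms(2) by (simp add: op_spectrum_def)
  then obtain R where "(\<lambda>f. S f - \<mu> *\<^sub>C f) \<circ> R = id"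
    unfolding invertible_op_def by blast
  then obtain f where f: "S f - \<mu> *\<^sub>C f = single 0 x"
    by (metis comp_apply id_apply)
  have "norm (B n x) \<le> (cmod \<mu> * norm f) * cmod \<mu> ^ n" for n
    using norm_solution_coord[of \<mu> f 0 x n] assms(1) f norm_coord_le[of f n]
    by (simp add: mult_left_mono mult_ac)
  then show ?thesis
    by (rule exp_growth_le_geometric[rotated 2]) auto
qed

text \<open>
  This makes the spectrum non-empty and its supremum non-negative.
\<close>

lemma zero_in_spectrum:
  assumes "h \<noteq> (0 :: 'h)"
  shows "0 \<in> op_spectrum S"
proof (rule ccontr)
  assume "0 \<notin> op_spectrum S"
  then obtain R where "S \<circ> R = id"
    by (auto simp: op_spectrum_def invertible_op_def)
  then have "S (R (single 0 h)) = single 0 h"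
    by (metis comp_apply id_apply)
  then have "coord (single 0 h) 0 = 0"
    using coord_shift(1) by metis
  with assms show False
    by (simp add: single.rep_eq)
qed

lemma weight_product_bound:
  obtains M where "0 \<le> M" and "\<And>n k x. norm (B (n + k) x) \<le> M ^ n * norm (B k x)"
proof -
  obtain M where M: "0 \<le> M" "\<And>n x. norm (A n x) \<le> M * norm x"
    using uniformly_bounded_weightsE[OF weights] by blast
  have "norm (B (n + k) x) \<le> M ^ n * norm (B k x)" for n k x
  proof (induction n)
    case (Suc n)
    then show ?case
      using M(2)[of "n + k" "B (n + k) x"] mult_left_mono[OF Suc.IH M(1)] by (simp add: mult_ac)
  qed simp
  with M(1) show thesis
    by (rule that)
qed

text \<open>
  These bounds allow the extended real rates to be treated as non-negative real numbers.
\<close>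

lemma limsup_bounds:
  obtains M where "0 \<le> M" and "\<And>x. limsup (\<lambda>n. ereal (root n (norm (B n x)))) \<le> ereal M"
    and "\<And>x. 0 \<le> limsup (\<lambda>n. ereal (root n (norm (B n x))))"
proof -
  obtain M where M: "0 \<le> M" "\<And>n k x. norm (B (n + k) x) \<le> M ^ n * norm (B k x)"
    using weight_product_bound by blast
  have "exp_growth_le M (\<lambda>n. norm (B n x))" for x
    using M(2)[of _ 0 x] M(1)
    by (intro exp_growth_le_geometric[where C = "norm x"]) (auto simp: mult.commute)
  then have "limsup (\<lambda>n. ereal (root n (norm (B n x)))) \<le> ereal M" for x
    using exp_growth_le_iff_limsup[OF M(1)] by simp
  moreover have "0 \<le> limsup (\<lambda>n. ereal (root n (norm (B n x))))" for x
    by (rule le_Limsup) (auto simp: real_root_pos_pos_le)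
  ultimately show thesis
    using M(1) that by blast
qed

theorem spectral_radius_eq_R3_plus:
  assumes h: "h \<noteq> (0 :: 'h)" and C: "dunford_condition_C S"
  shows "ereal (op_spectral_radius S) = R3_plus A"
proof -
  let ?r = "\<lambda>x. limsup (\<lambda>n. ereal (root n (norm (B n x))))"
  obtain M where M: "0 \<le> M" "\<And>x. ?r x \<le> ereal M" "\<And>x. 0 \<le> ?r x"
    using limsup_bounds by blast
  have R3_upper: "?r x \<le> R3_plus A" if "x \<noteq> 0" for x
    using that unfolding R3_plus_def by (intro SUP_upper) simp
  have "0 \<le> R3_plus A"
    using M(3)[of h] R3_upper[OF h] by (rule order_trans)
  moreover have "R3_plus A \<le> ereal M"
    using M(2) unfolding R3_plus_def by (intro SUP_least)
  ultimately obtain R where R: "R3_plus A = ereal R" "0 \<le> R"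
    by (cases "R3_plus A") auto
  have growth_R: "exp_growth_le R (\<lambda>n. norm (B n x))" for x
  proof (cases "x = 0")
    case False
    then show ?thesis
      using R3_upper exp_growth_le_iff_limsup[OF R(2)] R(1) by simp
  qed (use R in \<open>simp add: exp_growth_le_zero\<close>)
  \<comment> \<open>This direction rests on condition (C); the converse inequality below holds for every shift.\<close>
  have spectrum_le: "cmod \<mu> \<le> R" if "\<mu> \<in> op_spectrum S" for \<mu>
    using resolvent_if_growth[OF C R(2) _ growth_R] that by (meson not_le)
  then have bdd: "bdd_above (cmod ` op_spectrum S)"
    by (intro bdd_aboveI2)
  have le_radius: "cmod \<mu> \<le> op_spectral_radius S" if "\<mu> \<in> op_spectrum S" for \<mu>
    unfolding op_spectral_radius_def by (rule cSUP_upper[OF that bdd])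
  have "op_spectral_radius S \<le> R"
    unfolding op_spectral_radius_def
    using zero_in_spectrum[OF h] spectrum_le by (intro cSUP_least) auto
  moreover have "0 \<le> op_spectral_radius S"
    using le_radius[OF zero_in_spectrum[OF h]] by simp
  have "exp_growth_le (op_spectral_radius S) (\<lambda>n. norm (B n x))" for x
    unfolding exp_growth_le_def
  proof (intro allI impI)
    fix t assume t: "op_spectral_radius S < t"
    \<comment> \<open>The point \<open>s\<close> of the resolvent set has modulus above the spectral radius, but still below \<open>t\<close>.\<close>
    obtain s where s: "op_spectral_radius S < s" "s < t"
      using dense[OF t] by blast
    then have "cmod (of_real s) = s"
      using \<open>0 \<le> op_spectral_radius S\<close> by simp
    moreover have "complex_of_real s \<notin> op_spectrum S"
      using le_radius s(1) calculation by fastforce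
    moreover have "s \<noteq> 0"
      using s \<open>0 \<le> op_spectral_radius S\<close> by simp
    ultimately have "exp_growth_le s (\<lambda>n. norm (B n x))"
      using growth_if_resolvent[of "of_real s" x] by simp
    then show "\<exists>C. \<forall>n. norm (B n x) \<le> C * t ^ n"
      using s(2) by (rule exp_growth_leD)
  qed
  then have "R3_plus A \<le> ereal (op_spectral_radius S)"
    unfolding R3_plus_def
    using exp_growth_le_iff_limsup[OF \<open>0 \<le> op_spectral_radius S\<close>] by (intro SUP_least) simp
  ultimately show ?thesis
    using R(1) by simp
qed

theorem limsup_eq_lim_of_ratios:
  assumes C: "dunford_condition_C S" and "x \<noteq> 0"
  shows "(\<lambda>n. ereal (root n (SUP k. norm (B (n + k) x) / norm (B k x))))
    \<longlonglongrightarrow> limsup (\<lambda>n. ereal (root n (norm (B n x))))"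
proof -
  define u where "u n = norm (B n x)" for n
  define a where "a n = (SUP k. u (n + k) / u k)" for n
  have pos: "0 < u n" for n
    using \<open>x \<noteq> 0\<close> by (simp add: u_def)
  obtain M where M: "0 \<le> M" "\<And>n k x. norm (B (n + k) x) \<le> M ^ n * norm (B k x)"
    using weight_product_bound by blast
  have bdd: "bdd_above (range (\<lambda>k. u (n + k) / u k))" for n
    using M(2) pos by (intro bdd_aboveI2[where M = "M ^ n"]) (simp add: u_def divide_simps)
  have step: "u (n + k) \<le> a n * u k" for n k
  proof -
    have "u (n + k) / u k \<le> a n"
      unfolding a_def by (rule cSUP_upper[OF UNIV_I bdd])
    then show ?thesis
      using pos[of k] by (simp add: divide_simps)
  qed
  obtain \<rho> where \<rho>: "limsup (\<lambda>n. ereal (root n (u n))) = ereal \<rho>" "0 \<le> \<rho>"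
  proof -
    obtain M' where "limsup (\<lambda>n. ereal (root n (u n))) \<le> ereal M'"
      "0 \<le> limsup (\<lambda>n. ereal (root n (u n)))"
      unfolding u_def using limsup_bounds by metis
    then show thesis
      using that by (cases "limsup (\<lambda>n. ereal (root n (u n)))") auto
  qed
  have growth_u: "exp_growth_le \<rho> u"
    using exp_growth_le_iff_limsup[OF \<rho>(2), of u] \<rho>(1) pos by (simp add: less_imp_le)
  have "exp_growth_le \<rho> a"
    unfolding exp_growth_le_def
  proof (intro allI impI)
    fix t assume "\<rho> < t"
    define \<mu> where "\<mu> = complex_of_real t"
    have \<mu>: "\<rho> < cmod \<mu>" "\<mu> \<noteq> 0" "cmod \<mu> = t"
      using \<open>\<rho> < t\<close> \<rho>(2) by (simp_all add: \<mu>_def)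
    \<comment> \<open>All multiples of \<open>x\<close> have rate at most \<open>\<rho>\<close>, so the equation is solvable on the range of this map.\<close>
    let ?\<Phi> = "unit_combination (\<lambda>k. B k x)"
    have ex: "\<exists>f. S f - \<mu> *\<^sub>C f = ?\<Phi> c" for c
    proof -
      have "exp_growth_le \<rho> (\<lambda>n. norm (B n (r *\<^sub>R x)))" for r
        using exp_growth_le_cmult[OF growth_u, of "\<bar>r\<bar>"] by (simp add: weight_product_scaleR u_def)
      moreover have "coord (?\<Phi> c) k = B k ((coord c k / u k) *\<^sub>R x)" for k
        by (simp add: unit_combination.rep_eq sgn_div_norm weight_product_scaleR u_def divide_inverse)
      ultimately have "local_spectrum S (?\<Phi> c) \<subseteq> cball 0 \<rho>"
        by (intro local_spectrum_subset_cball_of_coords[OF C \<rho>(2)]) blast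
      then show ?thesis
        using solution_exists[OF _ \<mu>(1)] by metis
    qed
    obtain K where K: "\<And>c f. S f - \<mu> *\<^sub>C f = ?\<Phi> c \<Longrightarrow> norm f \<le> K * norm c"
      using solution_bounded[OF \<mu>(2) bounded_linear_unit_combination ex] by blast
    have "u (n + k) / u k \<le> (K * t) * t ^ n" for n k
    proof -
      \<comment> \<open>The unit vector in coordinate \<open>k\<close> tests the bound at the ratios with denominator \<open>u k\<close>.\<close>
      have \<Phi>_single: "?\<Phi> (single k 1) = single k (B k (inverse (u k) *\<^sub>R x))"
        by (rule hilbert_sum_eqI)
          (simp add: unit_combination.rep_eq single.rep_eq sgn_div_norm weight_product_scaleR u_def)
      obtain f where f: "S f - \<mu> *\<^sub>C f = ?\<Phi> (single k 1)"
        using ex by blast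
      have "norm f \<le> K"
        using K[OF f] by simp
      then have "norm (coord f (k + n)) \<le> K"
        using norm_coord_le order_trans by blast
      then have "norm (B (k + n) (inverse (u k) *\<^sub>R x)) \<le> t ^ Suc n * K"
        using norm_solution_coord[OF \<mu>(2) f[unfolded \<Phi>_single], of n] \<open>\<rho> < t\<close> \<rho>(2) \<mu>(3)
        by (simp add: mult_left_mono del: power_Suc)
      then show ?thesis
        using pos[of k] by (simp add: weight_product_scaleR u_def add.commute divide_inverse mult_ac)
    qed
    then have "a n \<le> (K * t) * t ^ n" for n
      unfolding a_def by (intro cSUP_least) auto
    then show "\<exists>C. \<forall>n. a n \<le> C * t ^ n"
      by blast
  qed
  from root_of_ratio_bound_tendsto[OF pos step \<rho> this] show ?thesis
    unfolding a_def u_def .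
qed

end


theorem theorem4p1:
  fixes A :: "nat \<Rightarrow> 'h::complex_hilbert \<Rightarrow> 'h"
  assumes "\<exists>h::'h. h \<noteq> 0"
    and "uniformly_bounded_weights A"
    and "\<forall>n. invertible_op (A n)"
    and "dunford_condition_C (unilateral_shift A)"
  shows "ereal (op_spectral_radius (unilateral_shift A)) = R3_plus A \<and>
    (\<forall>x::'h. x \<noteq> 0 \<longrightarrow>
      (\<lambda>n. ereal (root n (SUP k. norm (weight_product A (n + k) x) / norm (weight_product A k x))))
        \<longlonglongrightarrow> limsup (\<lambda>n. ereal (root n (norm (weight_product A n x)))))"
proof -
  interpret invertible_weighted_shift A
    using assms(2,3) by unfold_locales auto
  obtain h :: 'h where "h \<noteq> 0"
    using assms(1) ..
  then show ?thesis
    using spectral_radius_eq_R3_plus[OF _ assms(4)] limsup_eq_lim_of_ratios[OF assms(4)]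
    by (intro conjI allI impI)
qed

end
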